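(* Let $\alpha^\pm\in\mathcal A_+^{m^\pm}$. Let $f:\mathbb R\to\mathbb R$ be continuous and suppose that: the limits $f_{\pm\infty}:=\lim_{s\to\pm\infty}f(s)/s$ exist with $0<f_{\pm\infty}<\infty$; $f(0)=0$ and the limit $f_0:=\lim_{s\to0}f(s)/s$ exists, is finite, and satisfies $f_0>0$; and $$sf(s)>0,\qquad s\neq0.$$ If $$\Big(\frac{\lambda_k}{f_0}-1\Big)\big(\lambda_{k,\nu}(f_\infty,f_{-\infty})-1\big)<0$$ for some integer $k\ge1$ and some $\nu\in\{\pm\}$, then the problem $$-u''=f(u)\ \text{ on }(-1,1),\qquad u\in X,$$ has a solution $u\in T_{k,\nu}$.
   Context: For an integer $m\ge1$, $\mathcal A_+^m$ is the set of $\alpha\in\mathbb R^m$ with $\alpha_i\ge0$ for all $i$ and $\sum_{i=1}^m\alpha_i<1$. Fixed data: integers $m^\pm\ge1$, coefficients $\alpha^\pm\in\mathcal A_+^{m^\pm}$, points $\eta^\pm\in(-1,1)^{m^\pm}$. Let $X$ be the set of $u\in C^2[-1,1]$ satisfying both boundary conditions $u(\pm1)=\sum_{i=1}^{m^\pm}\alpha_i^\pm u(\eta_i^\pm)$. Write $u^\pm(x)=\max\{\pm u(x),0\}$, and $f(u)$ for the function $x\mapsto f(u(x))$. A zero $x_0$ of a $C^1$ function $v$ is simple if $v'(x_0)\neq0$. For $k\ge1$, $\nu\in\{\pm\}$, $T_{k,\nu}\subset X$ is the set of $u\in X$ such that: (a) $u'(\pm1)\ne0$ and $\nu u'(-1)>0$;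 (b) $u'$ has only simple zeros in $(-1,1)$, and has exactly $k$ such zeros; (c) $u$ has a zero strictly between each pair of consecutive zeros of $u'$. It is known that for $a,b>0$, $k\ge1$, $\nu\in\{\pm\}$ there is exactly one $\lambda>0$, denoted $\lambda_{k,\nu}(a,b)$, such that $-u''=\lambda(au^+-bu^-)$ on $(-1,1)$, $u\in X$, has a solution $u\in T_{k,\nu}$. The numbers $\lambda_k$, $k\ge1$, are the eigenvalues of the linear problem $-u''=\lambda u$, $u\in X$, i.e. $\lambda_k=\lambda_{k,+}(1,1)=\lambda_{k,-}(1,1)$, and $\lambda_k$ has an eigenfunction in $T_{k,+}$. *)

theory Defs
  imports "HOL-Analysis.Analysis"
begin

text \<open>
  Functions on [-1,1] are represented by total functions on the reals. Everything below
  depends only on their values on [-1,1]: derivatives are taken within [-1,1], hence are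
  one-sided at the end points.
\<close>

definition D :: "(real \<Rightarrow> real) \<Rightarrow> real \<Rightarrow> real" where
  "D u x = vector_derivative u (at x within {-1..1})"

definition C2 :: "(real \<Rightarrow> real) set" where
  "C2 = {u. u differentiable_on {-1..1} \<and> D u differentiable_on {-1..1} \<and>
            continuous_on {-1..1} (D (D u))}"

definition A_plus :: "(real ^ 'm) set" where
  "A_plus = {\<alpha>. (\<forall>i. 0 \<le> \<alpha> $ i) \<and> (\<Sum>i\<in>UNIV. \<alpha> $ i) < 1}"

text \<open>
  In the following definitions \<open>\<alpha>m, \<eta>m\<close> are the coefficients and points of the
  condition at -1, and \<open>\<alpha>p, \<eta>p\<close> those of the condition at 1. The numbers of points
  are the cardinalities of the (finite, nonempty) index types \<open>'m\<close> and \<open>'n\<close>.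
\<close>

definition X :: "real ^ 'm \<Rightarrow> real ^ 'm \<Rightarrow> real ^ 'n \<Rightarrow> real ^ 'n \<Rightarrow> (real \<Rightarrow> real) set" where
  "X \<alpha>m \<eta>m \<alpha>p \<eta>p = {u \<in> C2.
     u (-1) = (\<Sum>i\<in>UNIV. \<alpha>m $ i * u (\<eta>m $ i)) \<and>
     u 1 = (\<Sum>i\<in>UNIV. \<alpha>p $ i * u (\<eta>p $ i))}"

definition pos_part :: "(real \<Rightarrow> real) \<Rightarrow> real \<Rightarrow> real" where
  "pos_part u x = max (u x) 0"

definition neg_part :: "(real \<Rightarrow> real) \<Rightarrow> real \<Rightarrow> real" where
  "neg_part u x = max (- u x) 0"

definition simple_zero :: "(real \<Rightarrow> real) \<Rightarrow> real \<Rightarrow> bool" where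
  "simple_zero v x \<longleftrightarrow> v x = 0 \<and> D v x \<noteq> 0"

text \<open>The sign \<open>\<nu>\<close> is the real number 1 or -1.\<close>

definition T :: "real ^ 'm \<Rightarrow> real ^ 'm \<Rightarrow> real ^ 'n \<Rightarrow> real ^ 'n \<Rightarrow> nat \<Rightarrow> real \<Rightarrow>
    (real \<Rightarrow> real) set" where
  "T \<alpha>m \<eta>m \<alpha>p \<eta>p k \<nu> = {u \<in> X \<alpha>m \<eta>m \<alpha>p \<eta>p.
     D u (-1) \<noteq> 0 \<and> D u 1 \<noteq> 0 \<and> \<nu> * D u (-1) > 0 \<and>
     (\<forall>x\<in>{-1<..<1}. D u x = 0 \<longrightarrow> simple_zero (D u) x) \<and>
     finite {x \<in> {-1<..<1}. D u x = 0} \<and> card {x \<in> {-1<..<1}. D u x = 0} = k \<and>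
     (\<forall>x\<in>{-1<..<1}. \<forall>y\<in>{-1<..<1}.
        x < y \<and> D u x = 0 \<and> D u y = 0 \<and> (\<forall>z\<in>{x<..<y}. D u z \<noteq> 0)
        \<longrightarrow> (\<exists>z\<in>{x<..<y}. u z = 0))}"

definition half_eigenvalue ::
    "real ^ 'm \<Rightarrow> real ^ 'm \<Rightarrow> real ^ 'n \<Rightarrow> real ^ 'n \<Rightarrow> nat \<Rightarrow> real \<Rightarrow> real \<Rightarrow> real \<Rightarrow> real" where
  "half_eigenvalue \<alpha>m \<eta>m \<alpha>p \<eta>p k \<nu> a b =
     (THE \<mu>. \<mu> > 0 \<and> (\<exists>u\<in>T \<alpha>m \<eta>m \<alpha>p \<eta>p k \<nu>. \<forall>x\<in>{-1<..<1}.
        - D (D u) x = \<mu> * (a * pos_part u x - b * neg_part u x)))"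

definition eigenvalue ::
    "real ^ 'm \<Rightarrow> real ^ 'm \<Rightarrow> real ^ 'n \<Rightarrow> real ^ 'n \<Rightarrow> nat \<Rightarrow> real" where
  "eigenvalue \<alpha>m \<eta>m \<alpha>p \<eta>p k = half_eigenvalue \<alpha>m \<eta>m \<alpha>p \<eta>p k 1 1 1"

text \<open>With a = b = 1 the equation is the linear one:\<close>

lemma eigenvalue_linear:
  "eigenvalue \<alpha>m \<eta>m \<alpha>p \<eta>p k =
     (THE \<mu>. \<mu> > 0 \<and> (\<exists>u\<in>T \<alpha>m \<eta>m \<alpha>p \<eta>p k 1. \<forall>x\<in>{-1<..<1}. - D (D u) x = \<mu> * u x))"
proof -
  have "1 * pos_part u x - 1 * neg_part u x = u x" for u x
    by (simp add: pos_part_def neg_part_def max_def)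
  then show ?thesis
    by (simp only: eigenvalue_def half_eigenvalue_def)
qed

end

theory Submission
  imports Defs
begin

text \<open>
  The phase plane of \<open>-u'' = f(u)\<close> is uniformised by the angle \<open>\<theta>\<close> with
  \<open>\<phi>(u) = R sin \<theta>\<close> and \<open>u' = R cos \<theta>\<close>, where \<open>\<phi>(u) = sgn u \<surd>(2F(u))\<close> and \<open>F' = f\<close>. Along
  an orbit \<open>R\<close> is constant and \<open>\<theta>\<close> increases, so membership in \<open>T\<close> only says in which
  half turns the angles at the two end points lie. After rescaling \<open>R\<close> to 1 the orbits of
  energy \<open>R\<close> become those of \<open>f(Rx)/R\<close>; with \<open>R = s/(1-s)\<close> this family extends continuously to
  the linear problem at \<open>s = 0\<close> and to the half-linear problem at \<open>s = 1\<close>. A boundary condition at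
  one end changes sign across each half turn, because an extremal value of \<open>u\<close> cannot be a
  sub-average of other values. It remains to match the time spent between the two ends with the
  length 2 of the interval. This is a zero of a map in the variables \<open>s\<close> and the two end angles,
  found by Brouwer's theorem once the time defect has opposite signs at \<open>s = 0\<close> and \<open>s = 1\<close>.

  These signs are those of the two factors in the hypothesis. For a half-linear problem the energy
  is convex, which makes the boundary functions strictly monotone at their zeros; this gives
  uniqueness of the half-eigenvalue and decides the sign of the time defect by comparing it with 1.
\<close>

section \<open>Real analysis\<close>

text \<open>Since \<open>f\<close> is only continuous, orbits are not taken from an existence
  theorem with a Lipschitz condition; they are built by quadrature from the conserved energy, and
  what makes this uniform along the family is a pair of bounds \<open>c1\<close>, \<open>c2\<close>
  on g(x)/x. The obstacle is that the energy of \<open>f\<close> need not be convex. For 0 < s < 1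
  no uniqueness of the zero of a boundary function inside a half turn is available, so the end
  angles cannot be followed as continuous functions of \<open>s\<close>; the two end conditions and
  the time condition are solved simultaneously. Convexity enters only at the two extreme problems,
  where the sign of the time defect has to be known at every admissible pair of end angles.
  \<open>half_eigenvalue\<close> is a definite description, so a comparison with it presupposes
  existence and uniqueness. Existence comes from the same shooting lemma, with the nonlinearity
  fixed and the length of the interval as parameter. Finally \<lambda>_k / f0 is the half-eigenvalue
  of the pair (f0, f0), for either sign \<nu> because u can be replaced by -u; thus one comparison
  serves both factors.\<close>

lemma has_real_derivative_removable:
  fixes h h' :: "real \<Rightarrow> real"
  assumes h: "isCont h t" and h': "isCont h' t"
    and der: "eventually (\<lambda>x. (h has_real_derivative h' x) (at x)) (at t)"
  shows "(h has_real_derivative h' t) (at t)"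
proof -
  have "((\<lambda>x. (h x - h t) / (x - t)) \<longlongrightarrow> h' t) (at t)"
  proof (rule lhopital[where f' = h' and g' = "\<lambda>_. 1"])
    show "((\<lambda>x. h x - h t) \<longlongrightarrow> 0) (at t)"
      using h by (simp add: isCont_def LIM_zero)
    show "((\<lambda>x. x - t) \<longlongrightarrow> 0) (at t)"
      by (rule LIM_zero) simp
    show "eventually (\<lambda>x. x - t \<noteq> 0) (at t)"
      by (simp add: eventually_at_filter)
    show "eventually (\<lambda>x. ((\<lambda>x. h x - h t) has_real_derivative h' x) (at x)) (at t)"
      using der by eventually_elim (auto intro!: derivative_eq_intros)
  qed (use h' in \<open>auto intro!: always_eventually derivative_eq_intros simp: isCont_def\<close>)
  then show ?thesis
    by (simp add: has_field_derivative_iff)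
qed

text \<open>Just after a zero crossed upwards \<open>p\<close> is positive, and just before the next
  zero it would have to be negative; a further zero then lies in between.\<close>

lemma same_zero_contradiction:
  fixes p p' :: "real \<Rightarrow> real"
  assumes der: "\<And>t. (p has_real_derivative p' t) (at t)"
    and pos: "\<And>t. t \<in> {0..1} \<Longrightarrow> p t = 0 \<Longrightarrow> p' t > 0"
    and zeros: "p 0 = 0" "p 1 = 0"
  shows False
proof -
  have cont: "continuous_on S p" for S
    by (rule continuous_at_imp_continuous_on) (simp add: DERIV_isCont[OF der])
  have "p' 0 > 0"
    using pos[of 0] zeros by simp
  from DERIV_pos_inc_right[OF der this]
  obtain d0 where d0: "d0 > 0" "\<And>h. 0 < h \<Longrightarrow> h < d0 \<Longrightarrow> p 0 < p (0 + h)"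
    by blast
  define \<delta> where "\<delta> = min (d0 / 2) (1 / 2)"
  have \<delta>: "0 < \<delta>" "\<delta> < 1" "p \<delta> > 0"
    using d0(1) d0(2)[of \<delta>] zeros by (auto simp: \<delta>_def min_def split: if_splits)
  \<comment> \<open>Cutting off at \<open>\<delta>\<close> excludes the zero at 0, so the remaining
    zeros form a compact set and there is a first one.\<close>
  define S where "S = {t \<in> {\<delta>..1}. p t = 0}"
  have "closed S"
    unfolding S_def by (intro continuous_closed_preimage_constant cont) auto
  moreover have "bounded S"
    by (rule bounded_subset[of "{\<delta>..1}"]) (auto simp: S_def)
  ultimately have "compact S"
    by (simp add: compact_eq_bounded_closed)
  moreover have "1 \<in> S"
    using zeros \<delta> by (simp add: S_def)
  ultimately obtain z where z: "z \<in> S" "\<And>t. t \<in> S \<Longrightarrow> z \<le> t"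
    using compact_attains_inf[of S] by auto
  have z': "p z = 0" "\<delta> < z" "z \<le> 1"
    using z(1) \<delta> by (auto simp: S_def less_le)
  have "p' z > 0"
    using pos[of z] z' \<delta> by simp
  from DERIV_pos_inc_left[OF der this]
  obtain d1 where d1: "d1 > 0" "\<And>h. 0 < h \<Longrightarrow> h < d1 \<Longrightarrow> p (z - h) < p z"
    by blast
  define h where "h = min (d1 / 2) ((z - \<delta>) / 2)"
  have h: "0 < h" "h < d1" "\<delta> < z - h"
    using d1(1) z' by (auto simp: h_def min_def field_simps)
  have neg: "p (z - h) < 0"
    using d1(2)[OF h(1,2)] z' by simp
  obtain y where "\<delta> \<le> y" "y \<le> z - h" "p y = 0"
    using IVT2'[of p "z - h" 0 \<delta>] neg \<delta> h cont by (meson less_imp_le)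
  then show False
    using z(2)[of y] h z' by (auto simp: S_def)
qed

text \<open>The oriented integral from 0: whatever the sign of \<open>x\<close>, one of the two
  intervals is empty or a point and contributes 0.\<close>

definition primitive :: "(real \<Rightarrow> real) \<Rightarrow> real \<Rightarrow> real" where
  "primitive h x = integral {0..x} h - integral {x..0} h"

lemma primitive_0 [simp]: "primitive h 0 = 0"
  by (simp add: primitive_def)

lemma primitive_diff:
  assumes int: "\<And>a b. h integrable_on {a..b}" and "a \<le> b"
  shows "primitive h b - primitive h a = integral {a..b} h"
proof -
  have null: "integral {x..y} h = 0" if "y \<le> x" for x y
    using that by (cases "x = y") auto
  consider "0 \<le> a" | "a < 0" "0 \<le> b" | "b < 0"
    by linarith
  then show ?thesis
  proof cases
    case 1
    then show ?thesis
      using Henstock_Kurzweil_Integration.integral_combine[of 0 a b h] assms null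
      by (auto simp: primitive_def)
  next
    case 2
    then show ?thesis
      using Henstock_Kurzweil_Integration.integral_combine[of a 0 b h] assms null
      by (auto simp: primitive_def)
  next
    case 3
    then show ?thesis
      using Henstock_Kurzweil_Integration.integral_combine[of a b 0 h] assms null
      by (auto simp: primitive_def)
  qed
qed

text \<open>Continuity is asked at the single point \<open>x\<close> because the integrand of
  \<open>time\<close> may jump where the sine vanishes.\<close>

lemma primitive_deriv:
  assumes int: "\<And>a b. h integrable_on {a..b}" and cont: "isCont h x"
  shows "(primitive h has_real_derivative h x) (at x)"
proof -
  have "((\<lambda>y. integral {x - 1..y} h) has_vector_derivative h x) (at x within {x - 1..x + 1})"
    by (rule integral_has_vector_derivative_continuous_at[where S = "{}", simplified])
      (simp_all add: int continuous_at_imp_continuous_at_within[OF cont])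
  then have "((\<lambda>y. integral {x - 1..y} h) has_vector_derivative h x) (at x)"
    by (simp add: at_within_Icc_at)
  then have "((\<lambda>y. integral {x - 1..y} h) has_real_derivative h x) (at x)"
    by (simp add: has_real_derivative_iff_has_vector_derivative)
  from DERIV_add[OF DERIV_const this]
  have der: "((\<lambda>y. primitive h (x - 1) + integral {x - 1..y} h) has_real_derivative h x) (at x)"
    by simp
  have "eventually (\<lambda>y. y > x - 1) (nhds x)"
    using eventually_nhds_in_open[of "{x - 1<..}" x] by simp
  then have ev: "eventually (\<lambda>y. primitive h (x - 1) + integral {x - 1..y} h = primitive h y) (nhds x)"
  proof eventually_elim
    case (elim y)
    then show ?case
      using primitive_diff[OF int, of "x - 1" y] by simp
  qed
  show ?thesis
    using DERIV_cong_ev[OF refl ev refl] der by blast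
qed

text \<open>Monotonicity traps \<open>k s t\<close> between two fixed test points as soon as
  \<open>h\<close> has the right sign of difference there, so continuity in \<open>s\<close> at
  these points alone yields joint continuity.\<close>

lemma increasing_family_inverse:
  fixes h :: "real \<Rightarrow> real \<Rightarrow> real"
  assumes mono: "\<And>s. s \<in> S \<Longrightarrow> strict_mono (h s)"
    and inv: "\<And>s t. s \<in> S \<Longrightarrow> h s (k s t) = t"
    and cont: "\<And>x. continuous_on S (\<lambda>s. h s x)"
  shows "continuous_on (S \<times> UNIV) (\<lambda>(s, t). k s t)"
proof -
  have "((\<lambda>p. k (fst p) (snd p)) \<longlongrightarrow> k s t) (at (s, t) within S \<times> UNIV)"
    if s: "s \<in> S" for s t
  proof (rule tendstoI)
    fix e :: real assume e: "e > 0"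
  let ?F = "at (s, t) within S \<times> UNIV"
  let ?x = "k s t"
  have S: "eventually (\<lambda>p. fst p \<in> S) ?F"
    unfolding eventually_at_topological by (intro exI[of _ UNIV]) auto
  have fst: "((\<lambda>p. h (fst p) y) \<longlongrightarrow> h s y) ?F" for y
  proof -
    have "continuous_on (S \<times> UNIV) (\<lambda>p :: real \<times> real. h (fst p) y)"
      by (rule continuous_on_compose2[OF cont[of y]]) (auto intro!: continuous_intros)
    then show ?thesis
      using s unfolding continuous_on_def by fastforce
  qed
  have snd: "((\<lambda>p. snd p) \<longlongrightarrow> t) ?F"
    by (intro tendsto_eq_intros) auto
  have up: "0 < h s (?x + e) - t"
    using inv[OF s, of t] strict_monoD[OF mono[OF s], of ?x "?x + e"] e by simp
  have dn: "0 < t - h s (?x - e)"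
    using inv[OF s, of t] strict_monoD[OF mono[OF s], of "?x - e" ?x] e by simp
  have "eventually (\<lambda>p. 0 < h (fst p) (?x + e) - snd p) ?F"
    by (rule order_tendstoD(1)[OF tendsto_diff[OF fst snd] up])
  moreover have "eventually (\<lambda>p. 0 < snd p - h (fst p) (?x - e)) ?F"
    by (rule order_tendstoD(1)[OF tendsto_diff[OF snd fst] dn])
  ultimately show "eventually (\<lambda>p. dist (k (fst p) (snd p)) (k s t) < e) ?F"
    using S
  proof eventually_elim
    case (elim p)
    then have "h (fst p) (k (fst p) (snd p)) < h (fst p) (?x + e)"
      and "h (fst p) (?x - e) < h (fst p) (k (fst p) (snd p))"
      using inv by auto
    then have "k (fst p) (snd p) < ?x + e" "?x - e < k (fst p) (snd p)"
      using strict_mono_less[OF mono[OF elim(3)]] by auto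
    then show ?case
      by (auto simp: dist_real_def)
  qed
  qed
  then show ?thesis
    unfolding continuous_on_def by (auto simp: case_prod_unfold)
qed

lemma lipschitz_family_continuous:
  fixes h :: "real \<Rightarrow> real \<Rightarrow> real"
  assumes lip: "\<And>s x y. s \<in> S \<Longrightarrow> \<bar>h s x - h s y\<bar> \<le> K * \<bar>x - y\<bar>"
    and cont: "\<And>x. continuous_on S (\<lambda>s. h s x)"
  shows "continuous_on (S \<times> UNIV) (\<lambda>(s, x). h s x)"
proof -
  have "((\<lambda>p. h (fst p) (snd p)) \<longlongrightarrow> h s x) (at (s, x) within S \<times> UNIV)"
    if s: "s \<in> S" for s x
  proof -
  let ?F = "at (s, x) within S \<times> UNIV"
  have S: "eventually (\<lambda>p. fst p \<in> S) ?F"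
    unfolding eventually_at_topological by (intro exI[of _ UNIV]) auto
  have "continuous_on (S \<times> UNIV) (\<lambda>p :: real \<times> real. h (fst p) x)"
    by (rule continuous_on_compose2[OF cont[of x]]) (auto intro!: continuous_intros)
  then have 1: "((\<lambda>p. h (fst p) x) \<longlongrightarrow> h s x) ?F"
    using s unfolding continuous_on_def by fastforce
  have "((\<lambda>p. K * \<bar>snd p - x\<bar>) \<longlongrightarrow> 0) ?F"
    by (auto intro!: tendsto_eq_intros)
  then have 2: "((\<lambda>p. h (fst p) (snd p) - h (fst p) x) \<longlongrightarrow> 0) ?F"
    by (rule Lim_null_comparison[rotated])
      (use S in \<open>auto elim!: eventually_mono intro: lip\<close>)
  from tendsto_add[OF 1 2]
  show ?thesis
    by simp
  qed
  then show ?thesis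
    unfolding continuous_on_def by (auto simp: case_prod_unfold)
qed

text \<open>An active truncation would put \<open>z\<close> at an end point, but there the sign of
  \<open>d\<close> displaces it inwards, where nothing is cut off.\<close>

lemma truncation_fixed:
  fixes z :: real
  assumes "l \<le> u" "max l (min u (z - d)) = z" "z = l \<Longrightarrow> d < 0" "z = u \<Longrightarrow> d > 0"
  shows "d = 0"
  using assms unfolding max_def min_def by (auto split: if_splits)

text \<open>The third condition is only imposed at common zeros of the first two functions. This
  suffices, since a fixed point of the truncated displacement map is such a common zero.\<close>

lemma poincare_miranda_3:
  fixes A B C :: "real \<times> real \<times> real \<Rightarrow> real" and a a' b b' :: real
  defines "Q \<equiv> {0..1} \<times> {a..a'} \<times> {b..b'}"
  assumes le: "a \<le> a'" "b \<le> b'"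
    and cont: "continuous_on Q A" "continuous_on Q B" "continuous_on Q C"
    and A: "\<And>s x y. (s, x, y) \<in> Q \<Longrightarrow> x = a \<Longrightarrow> A (s, x, y) < 0"
      "\<And>s x y. (s, x, y) \<in> Q \<Longrightarrow> x = a' \<Longrightarrow> A (s, x, y) > 0"
    and B: "\<And>s x y. (s, x, y) \<in> Q \<Longrightarrow> y = b \<Longrightarrow> B (s, x, y) < 0"
      "\<And>s x y. (s, x, y) \<in> Q \<Longrightarrow> y = b' \<Longrightarrow> B (s, x, y) > 0"
    and C: "\<And>x y. (0, x, y) \<in> Q \<Longrightarrow> A (0, x, y) = 0 \<Longrightarrow> B (0, x, y) = 0 \<Longrightarrow> C (0, x, y) < 0"
      "\<And>x y. (1, x, y) \<in> Q \<Longrightarrow> A (1, x, y) = 0 \<Longrightarrow> B (1, x, y) = 0 \<Longrightarrow> C (1, x, y) > 0"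
  obtains s x y where "0 < s" "s < 1" "a < x" "x < a'" "b < y" "y < b'"
    "A (s, x, y) = 0" "B (s, x, y) = 0" "C (s, x, y) = 0"
proof -
  define \<Phi> where "\<Phi> p = (max 0 (min 1 (fst p - C p)), max a (min a' (fst (snd p) - A p)),
    max b (min b' (snd (snd p) - B p)))" for p
  have "compact Q" "convex Q"
    unfolding Q_def by (intro compact_Times convex_Times compact_Icc convex_real_interval)+
  moreover have "(0, a, b) \<in> Q"
    unfolding Q_def using le by simp
  then have "Q \<noteq> {}"
    by blast
  moreover have "continuous_on Q \<Phi>"
    unfolding \<Phi>_def by (intro continuous_intros cont)
  moreover have "\<Phi> p \<in> Q" for p
    unfolding \<Phi>_def Q_def using le by simp
  then have "\<Phi> \<in> Q \<rightarrow> Q"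
    by blast
  ultimately obtain p where p: "p \<in> Q" "\<Phi> p = p"
    using brouwer by blast
  obtain s x y where sxy: "p = (s, x, y)"
    by (cases p) auto
  have Q: "(s, x, y) \<in> Q" and "\<Phi> (s, x, y) = (s, x, y)"
    using p sxy by auto
  then have fixp: "max 0 (min 1 (s - C (s, x, y))) = s" "max a (min a' (x - A (s, x, y))) = x"
      "max b (min b' (y - B (s, x, y))) = y"
    by (simp_all add: \<Phi>_def)
  have A0: "A (s, x, y) = 0"
    using truncation_fixed[OF le(1) fixp(2)] A[OF Q] by blast
  have B0: "B (s, x, y) = 0"
    using truncation_fixed[OF le(2) fixp(3)] B[OF Q] by blast
  have C0: "C (s, x, y) = 0"
    by (rule truncation_fixed[OF zero_le_one fixp(1)]) (use C[of x y] A0 B0 Q in auto)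
  have "s \<noteq> 0" "s \<noteq> 1"
    using C[of x y] A0 B0 C0 Q by force+
  moreover have "x \<noteq> a" "x \<noteq> a'" "y \<noteq> b" "y \<noteq> b'"
    using A[OF Q] B[OF Q] A0 B0 by force+
  ultimately have "0 < s" "s < 1" "a < x" "x < a'" "b < y" "y < b'"
    using Q by (auto simp: Q_def)
  then show ?thesis
    using that A0 B0 C0 by blast
qed

text \<open>A Gronwall estimate for the squared length of (w, w'). It later identifies a given
  half-linear solution with the orbit having the same data at -1.\<close>

lemma second_order_unique:
  fixes w w' w'' :: "real \<Rightarrow> real"
  assumes cont: "continuous_on {a..b} w" "continuous_on {a..b} w'"
    and der: "\<And>x. x \<in> {a<..<b} \<Longrightarrow> (w has_real_derivative w' x) (at x)"
      "\<And>x. x \<in> {a<..<b} \<Longrightarrow> (w' has_real_derivative w'' x) (at x)"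
    and bound: "\<And>x. x \<in> {a<..<b} \<Longrightarrow> \<bar>w'' x\<bar> \<le> K * \<bar>w x\<bar>" and "K \<ge> 0"
    and init: "w a = 0" "w' a = 0" and x: "x \<in> {a..b}"
  shows "w x = 0 \<and> w' x = 0"
proof -
  \<comment> \<open>The squared length grows at relative rate at most \<open>1 + K\<close>, so with
    this weight it cannot increase; the minus sign fits the monotonicity rule applied next.\<close>
  define E where "E x = - (((w x)\<^sup>2 + (w' x)\<^sup>2) * exp (- ((1 + K) * x)))" for x
  have "E a \<le> E x"
  proof (rule DERIV_nonneg_imp_increasing_open[where f = E])
    show "continuous_on {a..x} E"
      unfolding E_def using x
      by (intro continuous_intros continuous_on_subset[OF cont(1)] continuous_on_subset[OF cont(2)]) auto
    fix y assume y: "a < y" "y < x"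
    then have y': "y \<in> {a<..<b}" using x by auto
    let ?e = "exp (- ((1 + K) * y))"
    let ?d = "?e * ((1 + K) * ((w y)\<^sup>2 + (w' y)\<^sup>2) - 2 * (w' y * (w y + w'' y)))"
    have "(E has_real_derivative ?d) (at y)"
      unfolding E_def
      by (rule derivative_eq_intros der[OF y'] refl)+ (simp add: algebra_simps power2_eq_square)
    moreover have "2 * (w' y * (w y + w'' y)) \<le> (1 + K) * ((w y)\<^sup>2 + (w' y)\<^sup>2)"
    proof -
      have "w' y * (w y + w'' y) \<le> \<bar>w' y\<bar> * \<bar>w y + w'' y\<bar>"
        by (metis abs_ge_self abs_mult)
      also have "\<dots> \<le> \<bar>w' y\<bar> * ((1 + K) * \<bar>w y\<bar>)"
        using bound[OF y'] by (intro mult_left_mono) (auto simp: algebra_simps)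
      also have "\<dots> = (1 + K) * (\<bar>w' y\<bar> * \<bar>w y\<bar>)"
        by simp
      finally have 1: "2 * (w' y * (w y + w'' y)) \<le> (1 + K) * (2 * \<bar>w' y\<bar> * \<bar>w y\<bar>)"
        by simp
      have "2 * \<bar>w' y\<bar> * \<bar>w y\<bar> \<le> (w y)\<^sup>2 + (w' y)\<^sup>2"
        using sum_squares_bound[of "\<bar>w' y\<bar>" "\<bar>w y\<bar>"] by simp
      then have "(1 + K) * (2 * \<bar>w' y\<bar> * \<bar>w y\<bar>) \<le> (1 + K) * ((w y)\<^sup>2 + (w' y)\<^sup>2)"
        using \<open>K \<ge> 0\<close> by (intro mult_left_mono) auto
      with 1 show ?thesis by linarith
    qed
    ultimately show "\<exists>d. (E has_real_derivative d) (at y) \<and> 0 \<le> d"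
      by (intro exI[of _ ?d]) auto
  qed (use x in auto)
  then have "(w x)\<^sup>2 + (w' x)\<^sup>2 \<le> 0"
    using init by (simp add: E_def mult_le_0_iff)
  then show ?thesis
    by (simp add: sum_power2_le_zero_iff)
qed

section \<open>Orbits in angular coordinates\<close>

lemma strict_mono_inverse_continuous:
  fixes h k :: "real \<Rightarrow> real"
  assumes "strict_mono h" "\<And>t. h (k t) = t"
  shows "isCont k t"
proof -
  have "continuous_on (UNIV \<times> UNIV) (\<lambda>(s :: real, t). k t)"
    using increasing_family_inverse[of UNIV "\<lambda>_. h" "\<lambda>_. k"] assms by simp
  then have "continuous_on UNIV (\<lambda>t. (\<lambda>(s :: real, t). k t) (0, t))"
    by (rule continuous_on_compose2) (auto intro!: continuous_intros)
  then show ?thesis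
    by (simp add: continuous_on_eq_continuous_at)
qed

lemma strict_mono_surj_inv:
  assumes "strict_mono (h :: real \<Rightarrow> real)" "surj h"
  shows "h (inv h t) = t" "inv h (h x) = x" "strict_mono (inv h)" "isCont (inv h) t"
proof -
  show 1: "h (inv h t) = t" for t
    by (rule surj_f_inv_f[OF assms(2)])
  show "inv h (h x) = x"
    by (rule inv_f_f[OF strict_mono_imp_inj_on[OF assms(1)]])
  show "strict_mono (inv h)"
    by (rule strict_monoI) (metis 1 assms(1) strict_mono_less)
  show "isCont (inv h) t"
    using strict_mono_inverse_continuous[OF assms(1) 1] .
qed

lemma nonneg_of_deriv_sign:
  fixes h h' :: "real \<Rightarrow> real"
  assumes der: "\<And>x. (h has_real_derivative h' x) (at x)"
    and pos: "\<And>x. x \<ge> 0 \<Longrightarrow> h' x \<ge> 0" and neg: "\<And>x. x \<le> 0 \<Longrightarrow> h' x \<le> 0"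
    and "h 0 = 0"
  shows "h x \<ge> 0"
proof (cases "x \<ge> 0")
  case True
  have "h 0 \<le> h x"
    by (rule DERIV_nonneg_imp_nondecreasing[OF True]) (use der pos in blast)
  then show ?thesis using \<open>h 0 = 0\<close> by simp
next
  case False
  then have "x \<le> 0" by simp
  then have "h 0 \<le> h x"
    by (rule DERIV_nonpos_imp_nonincreasing) (use der neg in blast)
  then show ?thesis using \<open>h 0 = 0\<close> by simp
qed

text \<open>Bounds on g(x)/x, written without division. The normalisation
  \<open>c1 \<le> 1 \<le> c2\<close> makes the default value 1 of \<open>slowness\<close> satisfy
  the same bounds as its other values.\<close>

definition sector :: "real \<Rightarrow> real \<Rightarrow> (real \<Rightarrow> real) \<Rightarrow> bool" where
  "sector c1 c2 g \<longleftrightarrow> 0 < c1 \<and> c1 \<le> 1 \<and> 1 \<le> c2 \<and> continuous_on UNIV g \<and>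
     (\<forall>x\<ge>0. c1 * x \<le> g x \<and> g x \<le> c2 * x) \<and> (\<forall>x\<le>0. c2 * x \<le> g x \<and> g x \<le> c1 * x)"

definition energy_coord :: "(real \<Rightarrow> real) \<Rightarrow> real \<Rightarrow> real" where
  "energy_coord g x = sgn x * sqrt (2 * primitive g x)"

definition energy_inv :: "(real \<Rightarrow> real) \<Rightarrow> real \<Rightarrow> real" where
  "energy_inv g = inv (energy_coord g)"

text \<open>The derivative of the time with respect to the angle; its value at \<open>y = 0\<close> is immaterial, as
  long as it obeys the same bounds and does not depend on \<open>g\<close>.\<close>

definition slowness :: "(real \<Rightarrow> real) \<Rightarrow> real \<Rightarrow> real" where
  "slowness g y = (if y = 0 then 1 else y / g (energy_inv g y))"

text \<open>On the level R = 1 one has du = slowness(sin \<theta>) cos \<theta> d\<theta> and u' =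
  cos \<theta>. The factor cos \<theta> cancels in dt = du / u', which removes the usual singularity
  of the time integral at turning points.\<close>

definition time :: "(real \<Rightarrow> real) \<Rightarrow> real \<Rightarrow> real" where
  "time g = primitive (\<lambda>\<theta>. slowness g (sin \<theta>))"

definition phase :: "(real \<Rightarrow> real) \<Rightarrow> real \<Rightarrow> real" where
  "phase g = inv (time g)"

definition orbit :: "(real \<Rightarrow> real) \<Rightarrow> real \<Rightarrow> real" where
  "orbit g t = energy_inv g (sin (phase g t))"

section \<open>The orbits of a single nonlinearity\<close>

context
  fixes c1 c2 :: real and g :: "real \<Rightarrow> real"
  assumes sector: "sector c1 c2 g"
begin

lemma sector_const_pos: "c1 > 0" "c2 > 0"
  using sector by (auto simp: sector_def)

lemma sector_isCont: "isCont g x"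
  using sector by (simp add: sector_def continuous_on_eq_continuous_at)

lemma sector_integrable: "g integrable_on {a..b}"
  by (rule integrable_continuous_real) (simp add: continuous_at_imp_continuous_on sector_isCont)

lemma sector_bounds:
  "x \<ge> 0 \<Longrightarrow> c1 * x \<le> g x" "x \<ge> 0 \<Longrightarrow> g x \<le> c2 * x"
  "x \<le> 0 \<Longrightarrow> c2 * x \<le> g x" "x \<le> 0 \<Longrightarrow> g x \<le> c1 * x"
  using sector by (auto simp: sector_def)

lemma sector_at_0 [simp]: "g 0 = 0"
  using sector_bounds(1,2)[of 0] by simp

lemma sector_fun_pos: "x > 0 \<Longrightarrow> g x > 0" and sector_fun_neg: "x < 0 \<Longrightarrow> g x < 0"
proof -
  show "g x > 0" if "x > 0"
    using sector_bounds(1)[of x] mult_pos_pos[OF sector_const_pos(1) that] that by linarith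
  show "g x < 0" if "x < 0"
    using sector_bounds(4)[of x] mult_pos_neg[OF sector_const_pos(1) that] that by linarith
qed

lemma sector_eq_0_iff: "g x = 0 \<longleftrightarrow> x = 0"
  using sector_fun_pos[of x] sector_fun_neg[of x] by (cases x "0 :: real" rule: linorder_cases) auto

lemma sector_abs_bounds: "c1 * \<bar>x\<bar> \<le> \<bar>g x\<bar>" "\<bar>g x\<bar> \<le> c2 * \<bar>x\<bar>"
  using sector_bounds[of x] sector_fun_pos[of x] sector_fun_neg[of x]
  by (cases x "0 :: real" rule: linorder_cases; simp)+

lemma potential_deriv: "(primitive g has_real_derivative g x) (at x)"
  by (rule primitive_deriv[OF sector_integrable sector_isCont])

lemma potential_bounds: "c1 * x\<^sup>2 \<le> 2 * primitive g x" "2 * primitive g x \<le> c2 * x\<^sup>2"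
proof -
  have "0 \<le> 2 * primitive g x - c1 * x\<^sup>2"
    by (rule nonneg_of_deriv_sign[where h = "\<lambda>x. 2 * primitive g x - c1 * x\<^sup>2"
          and h' = "\<lambda>x. 2 * (g x - c1 * x)"])
      (auto intro!: derivative_eq_intros potential_deriv simp: sector_bounds)
  moreover have "0 \<le> c2 * x\<^sup>2 - 2 * primitive g x"
    by (rule nonneg_of_deriv_sign[where h = "\<lambda>x. c2 * x\<^sup>2 - 2 * primitive g x"
          and h' = "\<lambda>x. 2 * (c2 * x - g x)"])
      (auto intro!: derivative_eq_intros potential_deriv simp: sector_bounds)
  ultimately show "c1 * x\<^sup>2 \<le> 2 * primitive g x" "2 * primitive g x \<le> c2 * x\<^sup>2"
    by auto
qed

lemma potential_pos: "x \<noteq> 0 \<Longrightarrow> primitive g x > 0" and potential_nonneg: "primitive g x \<ge> 0"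
proof -
  show pos: "primitive g x > 0" if "x \<noteq> 0"
  proof -
    have "0 < c1 * x\<^sup>2"
      using sector_const_pos that by simp
    then show ?thesis
      using potential_bounds(1)[of x] by linarith
  qed
  then show "primitive g x \<ge> 0"
    by (cases "x = 0") auto
qed

lemma energy_coord_0 [simp]: "energy_coord g 0 = 0"
  by (simp add: energy_coord_def)

lemma energy_coord_sq: "(energy_coord g x)\<^sup>2 = 2 * primitive g x"
  using potential_nonneg[of x]
  by (cases "x = 0") (auto simp: energy_coord_def power_mult_distrib sgn_if)

lemma energy_coord_sgn: "sgn (energy_coord g x) = sgn x"
  using potential_pos[of x] by (cases "x = 0") (auto simp: energy_coord_def sgn_mult)

lemma energy_coord_abs_bounds:
  "sqrt c1 * \<bar>x\<bar> \<le> \<bar>energy_coord g x\<bar>" "\<bar>energy_coord g x\<bar> \<le> sqrt c2 * \<bar>x\<bar>"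
proof -
  have eq: "\<bar>energy_coord g x\<bar> = sqrt (2 * primitive g x)"
    using energy_coord_sq[of x] by (metis real_sqrt_abs)
  show "sqrt c1 * \<bar>x\<bar> \<le> \<bar>energy_coord g x\<bar>"
    unfolding eq using real_sqrt_le_mono[OF potential_bounds(1)[of x]]
    by (simp add: real_sqrt_mult)
  show "\<bar>energy_coord g x\<bar> \<le> sqrt c2 * \<bar>x\<bar>"
    unfolding eq using real_sqrt_le_mono[OF potential_bounds(2)[of x]]
    by (simp add: real_sqrt_mult)
qed

lemma energy_coord_deriv:
  assumes "x \<noteq> 0"
  shows "(energy_coord g has_real_derivative g x / energy_coord g x) (at x)"
proof -
  have pos: "0 < 2 * primitive g x"
    using potential_pos[OF assms] by simp
  have "((\<lambda>y. sgn x * sqrt (2 * primitive g y)) has_real_derivative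
      sgn x * (2 * g x * (inverse (sqrt (2 * primitive g x)) / 2))) (at x)"
    using pos by (auto intro!: derivative_eq_intros potential_deriv)
  moreover have "sgn x * (2 * g x * (inverse (sqrt (2 * primitive g x)) / 2)) = g x / energy_coord g x"
    using pos assms by (auto simp: energy_coord_def sgn_if field_simps)
  moreover have "eventually (\<lambda>y. sgn x * sqrt (2 * primitive g y) = energy_coord g y) (nhds x)"
  proof (cases "x > 0")
    case True
    then have "eventually (\<lambda>y. y > 0) (nhds x)"
      using eventually_nhds_in_open[of "{0<..}" x] by simp
    then show ?thesis
      by eventually_elim (use True in \<open>simp add: energy_coord_def\<close>)
  next
    case False
    then have "eventually (\<lambda>y. y < 0) (nhds x)"
      using eventually_nhds_in_open[of "{..<0}" x] assms by simp
    then show ?thesis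
      by eventually_elim (use False assms in \<open>simp add: energy_coord_def\<close>)
  qed
  ultimately show ?thesis
    using DERIV_cong_ev[OF refl _ refl] by metis
qed

lemma energy_coord_isCont: "isCont (energy_coord g) x"
proof (cases "x = 0")
  case True
  have "((\<lambda>y. sqrt c2 * \<bar>y\<bar>) \<longlongrightarrow> 0) (at 0)"
    by (auto intro!: tendsto_eq_intros)
  then have "(energy_coord g \<longlongrightarrow> 0) (at 0)"
    by (rule Lim_null_comparison[rotated]) (simp add: energy_coord_abs_bounds)
  then show ?thesis
    using True by (simp add: isCont_def)
qed (use energy_coord_deriv DERIV_isCont in blast)

lemma energy_coord_strict_mono: "strict_mono (energy_coord g)"
proof (rule strict_monoI)
  fix x y :: real
  assume xy: "x < y"
  have der: "\<exists>d. (energy_coord g has_real_derivative d) (at z) \<and> d > 0" if "z \<noteq> 0" for z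
  proof (intro exI conjI, rule energy_coord_deriv[OF that])
    show "g z / energy_coord g z > 0"
      using energy_coord_sgn[of z] sector_fun_pos[of z] sector_fun_neg[of z] that
      by (cases "z > 0") (auto simp: sgn_if divide_neg_neg split: if_splits)
  qed
  have cont: "continuous_on S (energy_coord g)" for S
    by (simp add: continuous_at_imp_continuous_on energy_coord_isCont)
  \<comment> \<open>The derivative is known only away from 0, so each half line is treated
    separately and the two are joined at 0.\<close>
  have pos: "energy_coord g a < energy_coord g b" if "a < b" "b \<le> 0 \<or> a \<ge> 0" for a b
    by (rule DERIV_pos_imp_increasing_open[OF that(1) _ cont]) (use der that in force)
  show "energy_coord g x < energy_coord g y"
    using pos[of x y] pos[of x 0] pos[of 0 y] xy by linarith
qed

lemma energy_coord_surj: "surj (energy_coord g)"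
proof (unfold surj_def, rule allI)
  fix y :: real
  define M where "M = \<bar>y\<bar> / sqrt c1"
  have M: "M \<ge> 0" "sqrt c1 * M = \<bar>y\<bar>"
    using sector_const_pos by (auto simp: M_def)
  have "\<bar>y\<bar> \<le> energy_coord g M" "energy_coord g (- M) \<le> - \<bar>y\<bar>"
    using energy_coord_abs_bounds(1)[of M] energy_coord_abs_bounds(1)[of "- M"] M
      energy_coord_sgn[of M] energy_coord_sgn[of "- M"]
    by (auto simp: sgn_if abs_if split: if_splits)
  then have "\<exists>x\<ge>-M. x \<le> M \<and> energy_coord g x = y"
    by (intro IVT') (use M in \<open>auto intro!: continuous_at_imp_continuous_on energy_coord_isCont\<close>)
  then show "\<exists>x. y = energy_coord g x"
    by blast
qed

lemmas energy_inv_props = strict_mono_surj_inv[OF energy_coord_strict_mono energy_coord_surj,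
    folded energy_inv_def]

lemma energy_inv_0 [simp]: "energy_inv g 0 = 0"
  using energy_inv_props(2)[of 0] by simp

lemma energy_inv_sgn: "sgn (energy_inv g y) = sgn y"
  using energy_coord_sgn[of "energy_inv g y"] by (simp add: energy_inv_props(1))

lemma energy_inv_eq_0_iff: "energy_inv g y = 0 \<longleftrightarrow> y = 0"
  by (metis energy_inv_sgn sgn_eq_0_iff)

lemma energy_inv_abs_bounds:
  "sqrt c1 * \<bar>energy_inv g y\<bar> \<le> \<bar>y\<bar>" "\<bar>y\<bar> \<le> sqrt c2 * \<bar>energy_inv g y\<bar>"
  using energy_coord_abs_bounds[of "energy_inv g y"] by (simp_all add: energy_inv_props(1))

lemma energy_inv_deriv:
  assumes "y \<noteq> 0"
  shows "(energy_inv g has_real_derivative slowness g y) (at y)"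
proof -
  have nz: "energy_inv g y \<noteq> 0"
    using assms by (simp add: energy_inv_eq_0_iff)
  have "(energy_inv g has_real_derivative inverse (g (energy_inv g y) / y)) (at y)"
  proof (rule DERIV_inverse_function[where f = "energy_coord g" and a = "y - 1" and b = "y + 1"])
    show "(energy_coord g has_real_derivative g (energy_inv g y) / y) (at (energy_inv g y))"
      using energy_coord_deriv[OF nz] by (simp add: energy_inv_props(1))
  qed (use assms nz sector_eq_0_iff energy_inv_props in auto)
  then show ?thesis
    using assms by (simp add: slowness_def)
qed

lemma slowness_bounds: "sqrt c1 / c2 \<le> slowness g y" "slowness g y \<le> sqrt c2 / c1"
proof -
  have c: "0 < c1" "c1 \<le> 1" "1 \<le> c2"
    using sector by (auto simp: sector_def)
  have "sqrt c1 / c2 \<le> slowness g y \<and> slowness g y \<le> sqrt c2 / c1"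
  proof (cases "y = 0")
    case True
    have "sqrt c1 \<le> sqrt 1" "sqrt 1 \<le> sqrt c2"
      using c by (intro real_sqrt_le_mono; simp)+
    then have "sqrt c1 \<le> c2" "c1 \<le> sqrt c2"
      using c unfolding real_sqrt_one by linarith+
    then show ?thesis
      using True c by (simp add: slowness_def)
  next
    case False
    define x where "x = energy_inv g y"
    have x: "x \<noteq> 0"
      using False by (simp add: x_def energy_inv_eq_0_iff)
    have "sgn (g x) = sgn y"
      using energy_inv_sgn[of y] sector_fun_pos[of x] sector_fun_neg[of x] x
      by (cases "x > 0") (auto simp: x_def sgn_if split: if_splits)
    then have "y / g x = \<bar>y\<bar> / \<bar>g x\<bar>"
      by (auto simp: sgn_if abs_if split: if_splits)
    moreover have "sqrt c1 / c2 \<le> \<bar>y\<bar> / \<bar>g x\<bar>"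
    proof -
      have "sqrt c1 / c2 = sqrt c1 * \<bar>x\<bar> / (c2 * \<bar>x\<bar>)"
        using x by simp
      also have "\<dots> \<le> \<bar>y\<bar> / \<bar>g x\<bar>"
        using energy_inv_abs_bounds(1)[of y] sector_abs_bounds(2)[of x] x sector_eq_0_iff[of x] c
        by (intro frac_le) (auto simp: x_def)
      finally show ?thesis .
    qed
    moreover have "\<bar>y\<bar> / \<bar>g x\<bar> \<le> sqrt c2 / c1"
    proof -
      have "\<bar>y\<bar> / \<bar>g x\<bar> \<le> sqrt c2 * \<bar>x\<bar> / (c1 * \<bar>x\<bar>)"
        using energy_inv_abs_bounds(2)[of y] sector_abs_bounds(1)[of x] x c
        by (intro frac_le) (auto simp: x_def)
      also have "\<dots> = sqrt c2 / c1"
        using x by simp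
      finally show ?thesis .
    qed
    ultimately show ?thesis
      using False by (simp add: slowness_def x_def)
  qed
  then show "sqrt c1 / c2 \<le> slowness g y" "slowness g y \<le> sqrt c2 / c1"
    by auto
qed

lemma slowness_pos: "slowness g y > 0"
  by (rule less_le_trans[OF _ slowness_bounds(1)]) (simp add: sector_const_pos)

lemma slowness_isCont:
  assumes "y \<noteq> 0"
  shows "isCont (slowness g) y"
proof -
  have "isCont (\<lambda>y. y / g (energy_inv g y)) y"
    using assms energy_inv_eq_0_iff sector_eq_0_iff
    by (intro continuous_intros isCont_o2[OF energy_inv_props(4) sector_isCont]) auto
  moreover have "eventually (\<lambda>y. y \<in> - {0}) (nhds y)"
    using assms by (intro eventually_nhds_in_open) auto
  then have "eventually (\<lambda>y. y / g (energy_inv g y) = slowness g y) (nhds y)"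
    by eventually_elim (simp add: slowness_def)
  ultimately show ?thesis
    using isCont_cong[of "\<lambda>y. y / g (energy_inv g y)" "slowness g" y] by simp
qed

text \<open>\<open>slowness g\<close> may jump at 0, for example when the one-sided slopes of
  \<open>g\<close> differ, so integrability is drawn from measurability and boundedness.\<close>

lemma slowness_integrable: "(\<lambda>\<theta>. slowness g (sin \<theta>)) integrable_on {a..b}"
proof (rule measurable_bounded_by_integrable_imp_integrable_real)
  have [measurable]: "g \<in> borel_measurable borel" "energy_inv g \<in> borel_measurable borel"
    by (auto intro!: borel_measurable_continuous_onI continuous_at_imp_continuous_on
        sector_isCont energy_inv_props(4))
  have "(\<lambda>\<theta>. slowness g (sin \<theta>)) \<in> borel_measurable borel"
    unfolding slowness_def by measurable
  then show "(\<lambda>\<theta>. slowness g (sin \<theta>)) \<in> borel_measurable (lebesgue_on {a..b})"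
    by (intro measurable_restrict_space1 measurable_completion) simp
  show "(\<lambda>_. sqrt c2 / c1) integrable_on {a..b}"
    by (rule integrable_const_ivl)
  show "\<bar>slowness g (sin \<theta>)\<bar> \<le> sqrt c2 / c1" for \<theta>
    using slowness_pos[of "sin \<theta>"] slowness_bounds(2)[of "sin \<theta>"] by simp
qed simp

lemma time_bounds:
  assumes "a \<le> b"
  shows "sqrt c1 / c2 * (b - a) \<le> time g b - time g a"
    "time g b - time g a \<le> sqrt c2 / c1 * (b - a)"
proof -
  have eq: "time g b - time g a = integral {a..b} (\<lambda>\<theta>. slowness g (sin \<theta>))"
    unfolding time_def by (rule primitive_diff[OF slowness_integrable assms])
  have "integral {a..b} (\<lambda>_. sqrt c1 / c2) \<le> integral {a..b} (\<lambda>\<theta>. slowness g (sin \<theta>))"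
    by (rule integral_le[OF integrable_const_ivl slowness_integrable slowness_bounds(1)])
  then show "sqrt c1 / c2 * (b - a) \<le> time g b - time g a"
    using assms by (simp add: eq mult.commute)
  have "integral {a..b} (\<lambda>\<theta>. slowness g (sin \<theta>)) \<le> integral {a..b} (\<lambda>_. sqrt c2 / c1)"
    by (rule integral_le[OF slowness_integrable integrable_const_ivl slowness_bounds(2)])
  then show "time g b - time g a \<le> sqrt c2 / c1 * (b - a)"
    using assms by (simp add: eq mult.commute)
qed

lemma time_lipschitz: "\<bar>time g a - time g b\<bar> \<le> sqrt c2 / c1 * \<bar>a - b\<bar>"
proof -
  have "0 \<le> sqrt c1 / c2 * \<bar>a - b\<bar>"
    using sector_const_pos by simp
  then show ?thesis
    using time_bounds[of a b] time_bounds[of b a] by (auto simp: abs_if split: if_splits)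
qed

lemma time_strict_mono: "strict_mono (time g)"
proof (rule strict_monoI)
  fix a b :: real
  assume "a < b"
  then have "0 < sqrt c1 / c2 * (b - a)"
    using sector_const_pos by simp
  then show "time g a < time g b"
    using time_bounds(1)[of a b] \<open>a < b\<close> by linarith
qed

lemma time_0 [simp]: "time g 0 = 0"
  by (simp add: time_def)

lemma time_isCont: "isCont (time g) \<theta>"
proof -
  have "((\<lambda>y. sqrt c2 / c1 * \<bar>y - \<theta>\<bar>) \<longlongrightarrow> 0) (at \<theta>)"
    using sector_const_pos by (auto intro!: tendsto_eq_intros)
  then have "((\<lambda>y. time g y - time g \<theta>) \<longlongrightarrow> 0) (at \<theta>)"
    by (rule Lim_null_comparison[rotated]) (use time_lipschitz sector_const_pos in simp)
  then show ?thesis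
    by (simp add: isCont_def LIM_zero_iff)
qed

lemma time_surj: "surj (time g)"
proof (unfold surj_def, rule allI)
  fix t :: real
  define M where "M = \<bar>t\<bar> / (sqrt c1 / c2)"
  have M: "M \<ge> 0" "sqrt c1 / c2 * M = \<bar>t\<bar>"
    using sector_const_pos by (auto simp: M_def field_simps)
  have "\<bar>t\<bar> \<le> time g M" "time g (- M) \<le> - \<bar>t\<bar>"
    using time_bounds(1)[of 0 M] time_bounds(1)[of "- M" 0] M by auto
  then have "time g (- M) \<le> t" "t \<le> time g M"
    by linarith+
  then have "\<exists>x\<ge>-M. x \<le> M \<and> time g x = t"
    by (intro IVT') (use M in \<open>auto intro!: continuous_at_imp_continuous_on time_isCont\<close>)
  then show "\<exists>x. t = time g x"
    by blast
qed

lemmas phase_props = strict_mono_surj_inv[OF time_strict_mono time_surj, folded phase_def]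

lemma phase_deriv:
  assumes "sin (phase g t) \<noteq> 0"
  shows "(phase g has_real_derivative inverse (slowness g (sin (phase g t)))) (at t)"
proof (rule DERIV_inverse_function[where f = "time g" and a = "t - 1" and b = "t + 1"])
  show "(time g has_real_derivative slowness g (sin (phase g t))) (at (phase g t))"
    unfolding time_def
    by (rule primitive_deriv[OF slowness_integrable])
      (rule isCont_o2[OF isCont_sin slowness_isCont[OF assms]])
  show "slowness g (sin (phase g t)) \<noteq> 0"
    using slowness_pos[of "sin (phase g t)"] by simp
qed (use phase_props in auto)

lemma orbit_isCont: "isCont (orbit g) t"
  unfolding orbit_def
  by (rule isCont_o2[OF isCont_o2[OF phase_props(4) isCont_sin] energy_inv_props(4)])

lemma eventually_sin_phase_nonzero: "eventually (\<lambda>x. sin (phase g x) \<noteq> 0) (at t)"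
proof -
  have "eventually (\<lambda>\<theta>. sin \<theta> \<noteq> 0) (at (phase g t))"
  proof (cases "sin (phase g t) = 0")
    case False
    have "(sin \<longlongrightarrow> sin (phase g t)) (at (phase g t))"
      by (intro tendsto_intros)
    from tendsto_imp_eventually_ne[OF this False] show ?thesis .
  next
    case True
    then have "cos (phase g t) \<noteq> 0"
      using sin_cos_squared_add[of "phase g t"] by auto
    moreover have "((\<lambda>\<theta>. (sin \<theta> - sin (phase g t)) / (\<theta> - phase g t)) \<longlongrightarrow> cos (phase g t)) (at (phase g t))"
      using DERIV_sin[of "phase g t"] by (simp add: has_field_derivative_iff)
    ultimately have "eventually (\<lambda>\<theta>. (sin \<theta> - sin (phase g t)) / (\<theta> - phase g t) \<noteq> 0) (at (phase g t))"
      using tendsto_imp_eventually_ne by blast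
    then show ?thesis
      by eventually_elim (use True in auto)
  qed
  moreover have "filterlim (phase g) (at (phase g t)) (at t)"
    unfolding filterlim_at
  proof
    show "eventually (\<lambda>x. phase g x \<in> UNIV \<and> phase g x \<noteq> phase g t) (at t)"
      using strict_mono_eq[OF phase_props(3)] by (auto simp: eventually_at_filter)
    show "(phase g \<longlongrightarrow> phase g t) (at t)"
      using phase_props(4) by (simp add: isCont_def)
  qed
  ultimately show ?thesis
    by (rule eventually_compose_filterlim)
qed

text \<open>The change of angle may have a corner where the orbit crosses zero, because the one-sided
  slopes of the nonlinearity at 0 may differ; there the derivatives are obtained as limits.\<close>

lemma orbit_deriv: "(orbit g has_real_derivative cos (phase g t)) (at t)"
proof (rule has_real_derivative_removable[where h' = "\<lambda>t. cos (phase g t)"])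
  show "eventually (\<lambda>x. (orbit g has_real_derivative cos (phase g x)) (at x)) (at t)"
    using eventually_sin_phase_nonzero
  proof eventually_elim
    case (elim x)
    have "((\<lambda>t. energy_inv g (sin (phase g t))) has_real_derivative
        slowness g (sin (phase g x)) * (cos (phase g x) * inverse (slowness g (sin (phase g x))))) (at x)"
      by (rule DERIV_chain2[OF energy_inv_deriv[OF elim] DERIV_chain2[OF DERIV_sin phase_deriv[OF elim]]])
    then show ?case
      using slowness_pos[of "sin (phase g x)"] by (simp add: orbit_def[abs_def] field_simps)
  qed
  show "isCont (\<lambda>t. cos (phase g t)) t"
    by (rule isCont_o2[OF phase_props(4) isCont_cos])
qed (rule orbit_isCont)

lemma orbit_deriv2: "((\<lambda>t. cos (phase g t)) has_real_derivative - g (orbit g t)) (at t)"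
proof (rule has_real_derivative_removable[where h' = "\<lambda>t. - g (orbit g t)"])
  show "eventually (\<lambda>x. ((\<lambda>t. cos (phase g t)) has_real_derivative - g (orbit g x)) (at x)) (at t)"
    using eventually_sin_phase_nonzero
  proof eventually_elim
    case (elim x)
    have "((\<lambda>t. cos (phase g t)) has_real_derivative
        - sin (phase g x) * inverse (slowness g (sin (phase g x)))) (at x)"
      by (rule DERIV_chain2[OF DERIV_cos phase_deriv[OF elim]])
    then show ?case
      using elim by (simp add: orbit_def slowness_def)
  qed
  show "isCont (\<lambda>t. cos (phase g t)) t"
    by (rule isCont_o2[OF phase_props(4) isCont_cos])
  show "isCont (\<lambda>t. - g (orbit g t)) t"
    by (intro continuous_intros isCont_o2[OF orbit_isCont sector_isCont])
qed

end

section \<open>Shooting\<close>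

lemma continuous_on_compose_pair:
  assumes "continuous_on (S \<times> UNIV) (\<lambda>(s, x). h s x)"
    and "continuous_on Y a" "continuous_on Y b" "\<And>y. y \<in> Y \<Longrightarrow> a y \<in> S"
  shows "continuous_on Y (\<lambda>y. h (a y) (b y))"
proof -
  have "continuous_on Y (\<lambda>y. (\<lambda>(s, x). h s x) (a y, b y))"
    by (rule continuous_on_compose2[OF assms(1)]) (use assms in \<open>auto intro!: continuous_intros\<close>)
  then show ?thesis by simp
qed

section \<open>Continuous dependence of orbits on the parameter\<close>

context
  fixes S :: "real set" and c1 c2 :: real and g :: "real \<Rightarrow> real \<Rightarrow> real"
  assumes sector_family: "\<And>s. s \<in> S \<Longrightarrow> sector c1 c2 (g s)"
    and g_jointly: "continuous_on (S \<times> UNIV) (\<lambda>(s, x). g s x)"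
begin

lemma energy_coord_family: "continuous_on S (\<lambda>s. energy_coord (g s) x)"
proof -
  have "continuous_on S (\<lambda>s. integral (cbox a b) (g s))" for a b :: real
    by (rule integral_continuous_on_param) (rule continuous_on_subset[OF g_jointly], auto)
  then show ?thesis
    unfolding energy_coord_def primitive_def by (intro continuous_intros) auto
qed

lemma energy_inv_family: "continuous_on (S \<times> UNIV) (\<lambda>(s, y). energy_inv (g s) y)"
  by (rule increasing_family_inverse[where h = "\<lambda>s. energy_coord (g s)"])
    (use sector_family energy_coord_strict_mono energy_inv_props(1) energy_coord_family in blast)+

lemma slowness_family: "continuous_on S (\<lambda>s. slowness (g s) y)"
proof (cases "y = 0")
  case False
  have "continuous_on S (\<lambda>s. energy_inv (g s) y)"
    by (rule continuous_on_compose_pair[OF energy_inv_family]) (auto intro!: continuous_intros)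
  then have "continuous_on S (\<lambda>s. g s (energy_inv (g s) y))"
    by (intro continuous_on_compose_pair[OF g_jointly]) (auto intro!: continuous_intros)
  moreover have "g s (energy_inv (g s) y) \<noteq> 0" if "s \<in> S" for s
    using False sector_eq_0_iff[OF sector_family[OF that]] energy_inv_eq_0_iff[OF sector_family[OF that]]
    by simp
  ultimately show ?thesis
    unfolding slowness_def using False by (auto intro!: continuous_intros)
qed (simp add: slowness_def)

lemma time_family_pointwise: "continuous_on S (\<lambda>s. time (g s) \<theta>)"
proof -
  have "continuous_on S (\<lambda>s. integral {a..b} (\<lambda>\<theta>. slowness (g s) (sin \<theta>)))" for a b :: real
    unfolding continuous_on_sequentially comp_def
  proof safe
    fix x :: "nat \<Rightarrow> real" and s
    assume s: "s \<in> S" "\<forall>n. x n \<in> S" "x \<longlonglongrightarrow> s"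
    show "(\<lambda>n. integral {a..b} (\<lambda>\<theta>. slowness (g (x n)) (sin \<theta>))) \<longlonglongrightarrow>
        integral {a..b} (\<lambda>\<theta>. slowness (g s) (sin \<theta>))"
    \<comment> \<open>The dominating constant is the same for all members of the family, and where
      the sine vanishes the integrand has its default value, constant in the parameter; so the
      convergence holds at every angle.\<close>
    proof (rule dominated_convergence(2))
      show "(\<lambda>\<theta>. slowness (g (x n)) (sin \<theta>)) integrable_on {a..b}" for n
        using slowness_integrable sector_family s by blast
      show "(\<lambda>_. sqrt c2 / c1) integrable_on {a..b}"
        by (rule integrable_const_ivl)
      show "norm (slowness (g (x n)) (sin \<theta>)) \<le> sqrt c2 / c1" for n \<theta>
        using slowness_bounds(2)[OF sector_family] slowness_pos[OF sector_family] s
        by (simp add: less_imp_le)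
      show "(\<lambda>n. slowness (g (x n)) (sin \<theta>)) \<longlonglongrightarrow> slowness (g s) (sin \<theta>)" for \<theta>
        using slowness_family[of "sin \<theta>"] s unfolding continuous_on_sequentially comp_def by blast
    qed
  qed
  then show ?thesis
    unfolding time_def primitive_def by (intro continuous_intros)
qed

lemma time_family: "continuous_on (S \<times> UNIV) (\<lambda>(s, \<theta>). time (g s) \<theta>)"
  by (rule lipschitz_family_continuous[OF time_lipschitz[OF sector_family] time_family_pointwise])

lemma phase_family: "continuous_on (S \<times> UNIV) (\<lambda>(s, t). phase (g s) t)"
  by (rule increasing_family_inverse[where h = "\<lambda>s. time (g s)"])
    (use sector_family time_strict_mono phase_props(1) time_family_pointwise in blast)+

lemma orbit_family: "continuous_on (S \<times> UNIV) (\<lambda>(s, t). orbit (g s) t)"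
proof -
  have "continuous_on (S \<times> UNIV) (\<lambda>p. energy_inv (g (fst p)) (sin (phase (g (fst p)) (snd p))))"
    by (intro continuous_on_compose_pair[OF energy_inv_family]
        continuous_on_compose_pair[OF phase_family] continuous_intros) auto
  then show ?thesis
    by (simp add: case_prod_unfold orbit_def)
qed

end

text \<open>The component of cos \<noteq> 0 centred at a zero of sin. Going from
  \<open>arc j\<close> to \<open>arc (j + k)\<close> the angle passes exactly \<open>k\<close> zeros
  of u', and the sign of u' on \<open>arc j\<close> is (-1)^j; so \<open>j\<close> carries the sign
  \<nu>.\<close>

definition arc :: "nat \<Rightarrow> real set" where
  "arc j = {real j * pi - pi / 2<..<real j * pi + pi / 2}"

lemma cos_arc:
  assumes "\<theta> \<in> arc j"
  shows "(-1) ^ j * cos \<theta> > 0"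
proof -
  have "cos \<theta> = cos (real j * pi + (\<theta> - real j * pi))"
    by simp
  also have "\<dots> = (-1) ^ j * cos (\<theta> - real j * pi)"
    unfolding cos_add by simp
  finally have "(-1) ^ j * cos \<theta> = cos (\<theta> - real j * pi)"
    by (simp add: power_mult_distrib[symmetric] flip: mult.assoc power_add)
  also have "\<dots> > 0"
    using assms by (intro cos_gt_zero_pi) (auto simp: arc_def)
  finally show ?thesis .
qed

lemma cos_arc_nonzero: "\<theta> \<in> arc j \<Longrightarrow> cos \<theta> \<noteq> 0"
  using cos_arc by force

lemma cos_zeros_between_arcs:
  fixes \<Phi> :: "real \<Rightarrow> real"
  assumes mono: "strict_mono \<Phi>" and cont: "\<And>x. isCont \<Phi> x" and "a < b"
    and ends: "\<Phi> a \<in> arc j" "\<Phi> b \<in> arc (j + k)"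
  shows "finite {x \<in> {a<..<b}. cos (\<Phi> x) = 0}" "card {x \<in> {a<..<b}. cos (\<Phi> x) = 0} = k"
proof -
  define Z where "Z = {x \<in> {a<..<b}. cos (\<Phi> x) = 0}"
  \<comment> \<open>\<open>h i\<close> is the right end point of \<open>arc i\<close>; the crossings
    are therefore those with \<open>j \<le> i < j + k\<close>.\<close>
  define h where "h i = real i * pi + pi / 2" for i
  have "\<Phi> ` Z = h ` {j..<j + k}"
  proof (intro equalityI subsetI)
    fix y assume "y \<in> \<Phi> ` Z"
    then obtain x where x: "a < x" "x < b" "cos y = 0" "y = \<Phi> x"
      by (auto simp: Z_def)
    then obtain n :: int where n: "y = n * pi + pi / 2"
      by (auto simp: cos_zero_iff_int2)
    have "\<Phi> a < y" "y < \<Phi> b"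
      using x strict_monoD[OF mono] by auto
    then have "real j * pi - pi / 2 < n * pi + pi / 2" "n * pi + pi / 2 < real (j + k) * pi + pi / 2"
      using ends n unfolding arc_def greaterThanLessThan_iff by linarith+
    moreover have "real_of_int (int j - 1) * pi = real j * pi - pi"
      by (simp add: algebra_simps)
    moreover have "real_of_int (int (j + k)) * pi = real (j + k) * pi"
      by simp
    ultimately have "real_of_int (int j - 1) * pi < n * pi" "real_of_int n * pi < real_of_int (int (j + k)) * pi"
      by linarith+
    then have "int j - 1 < n" "n < int (j + k)"
      by (simp_all only: mult_less_cancel_right_pos[OF pi_gt_zero] of_int_less_iff)
    then have "nat n \<in> {j..<j + k}" "y = h (nat n)"
      using n by (auto simp: h_def)
    then show "y \<in> h ` {j..<j + k}"
      by blast
  next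
    fix y assume "y \<in> h ` {j..<j + k}"
    then obtain i where i: "j \<le> i" "i < j + k" "y = h i"
      by auto
    have "real j * pi \<le> real i * pi" "real (i + 1) * pi \<le> real (j + k) * pi"
      using i by (intro mult_right_mono; simp)+
    moreover have "real (i + 1) * pi = real i * pi + pi"
      by (simp add: algebra_simps)
    ultimately have y: "\<Phi> a < y" "y < \<Phi> b"
      using ends i(3) unfolding arc_def h_def greaterThanLessThan_iff by linarith+
    then obtain x where x: "a \<le> x" "x \<le> b" "\<Phi> x = y"
      using IVT'[of \<Phi> a y b] \<open>a < b\<close> cont by (auto intro: continuous_at_imp_continuous_on)
    have "cos y = 0"
      using i by (auto simp: h_def cos_zero_iff_int2 intro!: exI[of _ "int i"])
    then have "x \<in> Z"
      using x y by (auto simp: Z_def less_le)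
    then show "y \<in> \<Phi> ` Z"
      using x by blast
  qed
  moreover have "inj_on \<Phi> Z"
    using strict_mono_imp_inj_on[OF mono] inj_on_subset by blast
  moreover have "inj_on h {j..<j + k}"
    by (auto simp: inj_on_def h_def)
  ultimately have "finite Z" "card Z = k"
    by (metis finite_atLeastLessThan finite_imageD finite_imageI,
        metis card_atLeastLessThan card_image diff_add_inverse)
  then show "finite {x \<in> {a<..<b}. cos (\<Phi> x) = 0}" "card {x \<in> {a<..<b}. cos (\<Phi> x) = 0} = k"
    by (simp_all add: Z_def)
qed

section \<open>From orbits to elements of T\<close>

lemma D_eqI:
  assumes "(u has_real_derivative d) (at x within {-1..1})" "x \<in> {-1..1}"
  shows "D u x = d"
  using assms unfolding D_def has_real_derivative_iff_has_vector_derivative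
  by (intro vector_derivative_within_closed_interval) auto

lemma D_within:
  assumes "v differentiable_on {-1..1}" "x \<in> {-1..1}"
  shows "(v has_real_derivative D v x) (at x within {-1..1})"
proof -
  have "v differentiable (at x within {-1..1})"
    using assms by (auto simp: differentiable_on_def)
  then obtain d where "(v has_real_derivative d) (at x within {-1..1})"
    using real_differentiableE by blast
  then show ?thesis
    using D_eqI[of v d x] assms(2) by simp
qed

lemma D_of_deriv:
  assumes u: "\<And>x. x \<in> {-1..1} \<Longrightarrow> (u has_real_derivative u' x) (at x within {-1..1})"
    and u': "\<And>x. x \<in> {-1..1} \<Longrightarrow> (u' has_real_derivative u'' x) (at x within {-1..1})"
    and x: "x \<in> {-1..1}"
  shows "D u x = u' x" "(D u has_real_derivative u'' x) (at x within {-1..1})" "D (D u) x = u'' x"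
proof -
  have eq: "D u y = u' y" if "y \<in> {-1..1}" for y
    using D_eqI[OF u[OF that] that] .
  then show "D u x = u' x"
    using x by blast
  have "(D u has_vector_derivative u'' x) (at x within {-1..1})"
    using u'[OF x] unfolding has_real_derivative_iff_has_vector_derivative
    by (intro has_vector_derivative_transform[OF x eq]) auto
  then show *: "(D u has_real_derivative u'' x) (at x within {-1..1})"
    by (simp add: has_real_derivative_iff_has_vector_derivative)
  show "D (D u) x = u'' x"
    by (rule D_eqI[OF * x])
qed

lemma C2_I:
  assumes u: "\<And>x. x \<in> {-1..1} \<Longrightarrow> (u has_real_derivative u' x) (at x within {-1..1})"
    and u': "\<And>x. x \<in> {-1..1} \<Longrightarrow> (u' has_real_derivative u'' x) (at x within {-1..1})"
    and "continuous_on {-1..1} u''"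
  shows "u \<in> C2"
proof -
  have "u differentiable_on {-1..1}"
    unfolding differentiable_on_def using u real_differentiable_def by blast
  moreover have "D u differentiable_on {-1..1}"
    unfolding differentiable_on_def using D_of_deriv(2)[OF u u'] real_differentiable_def by blast
  moreover have "continuous_on {-1..1} (D (D u))"
    using assms(3) D_of_deriv(3)[OF u u'] continuous_on_cong by (metis (no_types, lifting))
  ultimately show ?thesis
    by (simp add: C2_def)
qed

text \<open>The defect of the boundary condition at \<open>e = -1\<close> or \<open>e = 1\<close> for \<open>x \<mapsto> orbit g (m + l x)\<close>,
  where \<open>t = m + l e\<close> is the time at which the orbit passes the end point \<open>e\<close>.\<close>

definition end_bc :: "real \<Rightarrow> real ^ 'm \<Rightarrow> real ^ 'm \<Rightarrow> (real \<Rightarrow> real) \<Rightarrow> real \<Rightarrow> real \<Rightarrow> real" where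
  "end_bc e \<alpha> \<eta> g l t = orbit g t - (\<Sum>i\<in>UNIV. \<alpha> $ i * orbit g (t + l * (\<eta> $ i - e)))"

text \<open>The angle increases, so every clause of \<open>T\<close> can be read off it: where cos
  vanishes sin does not, and then neither does the second derivative. \<open>A\<close> undoes the
  rescaling of the energy and \<open>l\<close> is the half length of the interval in orbit time,
  which is the square root of the eigenvalue in half-linear problems.\<close>

lemma orbit_in_T:
  fixes \<alpha>m \<eta>m :: "real ^ 'm" and \<alpha>p \<eta>p :: "real ^ 'n"
  assumes sec: "sector c1 c2 g" and "A > 0" "l > 0"
    and arcs: "phase g t \<in> arc j" "phase g (t + 2 * l) \<in> arc (j + k)"
    and bc: "end_bc (-1) \<alpha>m \<eta>m g l t = 0" "end_bc 1 \<alpha>p \<eta>p g l (t + 2 * l) = 0"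
  defines "u \<equiv> \<lambda>x. A * orbit g (t + l * (x + 1))"
  shows "u \<in> T \<alpha>m \<eta>m \<alpha>p \<eta>p k ((-1) ^ j)"
    and "\<And>x. x \<in> {-1..1} \<Longrightarrow> D (D u) x = - (A * l\<^sup>2 * g (orbit g (t + l * (x + 1))))"
proof -
  define \<Phi> where "\<Phi> x = phase g (t + l * (x + 1))" for x
  define u' where "u' x = A * l * cos (\<Phi> x)" for x
  define u'' where "u'' x = - (A * l\<^sup>2 * g (orbit g (t + l * (x + 1))))" for x
  have u: "(u has_real_derivative u' x) (at x)" for x
    unfolding u_def u'_def \<Phi>_def
    by (auto intro!: derivative_eq_intros DERIV_chain2[OF orbit_deriv[OF sec]])
  have u': "(u' has_real_derivative u'' x) (at x)" for x
    unfolding u''_def u'_def \<Phi>_def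
    by (rule derivative_eq_intros DERIV_chain2[OF orbit_deriv2[OF sec]] refl)+
      (simp add: power2_eq_square)
  note u_within = has_field_derivative_at_within[OF u] has_field_derivative_at_within[OF u']
  have Du: "D u x = u' x" and DDu: "D (D u) x = u'' x" if "x \<in> {-1..1}" for x
    using D_of_deriv[of u u' u'' x] u_within that by auto
  then show "\<And>x. x \<in> {-1..1} \<Longrightarrow> D (D u) x = - (A * l\<^sup>2 * g (orbit g (t + l * (x + 1))))"
    by (simp add: u''_def)
  have cont: "isCont \<Phi> x" for x
    unfolding \<Phi>_def by (intro isCont_o2[OF _ phase_props(4)[OF sec]] continuous_intros)
  have mono: "strict_mono \<Phi>"
    unfolding \<Phi>_def
    by (intro strict_monoI strict_monoD[OF phase_props(3)[OF sec]]) (use \<open>l > 0\<close> in simp)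
  have ends: "\<Phi> (-1) \<in> arc j" "\<Phi> 1 \<in> arc (j + k)"
    using arcs by (auto simp: \<Phi>_def algebra_simps)
  have "continuous_on {-1..1} u''"
    unfolding u''_def
    by (intro continuous_at_imp_continuous_on ballI continuous_intros
        isCont_o2[OF _ sector_isCont[OF sec]] isCont_o2[OF _ orbit_isCont[OF sec]])
  then have "u \<in> C2"
    using C2_I[of u u' u''] u_within by blast
  moreover have "u (-1) = (\<Sum>i\<in>UNIV. \<alpha>m $ i * u (\<eta>m $ i))"
    using bc(1) by (simp add: u_def end_bc_def sum_distrib_left mult.left_commute)
  moreover have "u 1 = (\<Sum>i\<in>UNIV. \<alpha>p $ i * u (\<eta>p $ i))"
    using bc(2) by (simp add: u_def end_bc_def sum_distrib_left algebra_simps)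
  ultimately have "u \<in> X \<alpha>m \<eta>m \<alpha>p \<eta>p"
    by (simp add: X_def)
  moreover have "D u (-1) \<noteq> 0" "D u 1 \<noteq> 0" "(-1) ^ j * D u (-1) > 0"
    using cos_arc_nonzero[OF ends(1)] cos_arc_nonzero[OF ends(2)]
      mult_pos_pos[OF mult_pos_pos[OF \<open>A > 0\<close> \<open>l > 0\<close>] cos_arc[OF ends(1)]] \<open>A > 0\<close> \<open>l > 0\<close>
    by (auto simp: Du u'_def mult_ac)
  moreover have zeros: "D u x = 0 \<longleftrightarrow> cos (\<Phi> x) = 0" if "x \<in> {-1<..<1}" for x
    using that \<open>A > 0\<close> \<open>l > 0\<close> by (simp add: Du u'_def)
  have "simple_zero (D u) x" if x: "x \<in> {-1<..<1}" "D u x = 0" for x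
  proof -
    have "sin (\<Phi> x) \<noteq> 0"
      using zeros[OF x(1)] x(2) sin_cos_squared_add[of "\<Phi> x"] by auto
    then have "D (D u) x \<noteq> 0"
      using x(1) \<open>A > 0\<close> \<open>l > 0\<close> sector_eq_0_iff[OF sec] energy_inv_eq_0_iff[OF sec]
      by (simp add: DDu u''_def orbit_def \<Phi>_def)
    then show ?thesis
      using x by (simp add: simple_zero_def)
  qed
  moreover have "{x \<in> {-1<..<1}. D u x = 0} = {x \<in> {-1<..<1}. cos (\<Phi> x) = 0}"
    using zeros by blast
  then have "finite {x \<in> {-1<..<1}. D u x = 0}" "card {x \<in> {-1<..<1}. D u x = 0} = k"
    using cos_zeros_between_arcs[OF mono cont _ ends] by auto
  moreover have "\<exists>z\<in>{x<..<y}. u z = 0"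
    if xy: "x \<in> {-1<..<1}" "y \<in> {-1<..<1}" "x < y" "D u x = 0" "D u y = 0" for x y
  proof -
    obtain n m :: int where nm: "\<Phi> x = n * pi + pi / 2" "\<Phi> y = m * pi + pi / 2"
      using zeros xy cos_zero_iff_int2 by metis
    have "n * pi < m * pi"
      using strict_monoD[OF mono \<open>x < y\<close>] nm by simp
    then have "n + 1 \<le> m"
      by (simp add: mult_less_cancel_right_pos)
    then have "real_of_int (n + 1) * pi \<le> m * pi"
      by (intro mult_right_mono) (auto simp del: of_int_add)
    moreover have "real_of_int (n + 1) * pi = n * pi + pi"
      by (simp add: algebra_simps)
    \<comment> \<open>Between two critical angles lies a multiple of pi, and there \<open>u\<close>
      vanishes.\<close>
    ultimately have lt: "\<Phi> x < (n + 1) * pi" "(n + 1) * pi < \<Phi> y"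
      unfolding nm using pi_gt_zero by linarith+
    then obtain z where z: "x \<le> z" "z \<le> y" "\<Phi> z = (n + 1) * pi"
      using IVT'[of \<Phi> x "(n + 1) * pi" y] xy(3) cont by (auto intro: continuous_at_imp_continuous_on)
    have "sin (\<Phi> z) = 0"
      unfolding z(3) sin_zero_iff_int2 by (intro exI[of _ "n + 1"]) simp
    then have "u z = 0"
      by (simp add: u_def orbit_def \<Phi>_def energy_inv_0[OF sec])
    moreover have "x < z" "z < y"
      using lt z by (auto simp: less_le)
    ultimately show ?thesis
      by auto
  qed
  ultimately show "u \<in> T \<alpha>m \<eta>m \<alpha>p \<eta>p k ((-1) ^ j)"
    unfolding T_def by blast
qed

text \<open>When sin is 1 or -1 the orbit is at its global maximum or minimum. Nonnegative weights
  of total mass below 1 cannot reproduce that value, which is not zero. Orbits exist for all times,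
  so this holds for every \<open>l\<close> and every position of the points.\<close>

lemma extremal_end_bc:
  fixes \<alpha> \<eta> :: "real ^ 'm"
  assumes sec: "sector c1 c2 g" and \<alpha>: "\<alpha> \<in> A_plus" and \<sigma>: "sin (phase g t) = \<sigma>" "\<sigma> \<in> {1, -1}"
  shows "\<sigma> * end_bc e \<alpha> \<eta> g l t > 0"
proof -
  define M where "M = \<sigma> * energy_inv g \<sigma>"
  have "sgn (energy_inv g \<sigma>) = \<sigma>"
    using energy_inv_sgn[OF sec, of \<sigma>] \<sigma>(2) by auto
  then have "M > 0"
    using \<sigma>(2) by (auto simp: M_def sgn_if split: if_splits)
  have le: "\<sigma> * orbit g r \<le> M" for r
    using strict_mono_less_eq[OF energy_inv_props(3)[OF sec]] \<sigma>(2)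
    by (auto simp: M_def orbit_def)
  have "\<sigma> * (\<Sum>i\<in>UNIV. \<alpha> $ i * orbit g (t + l * (\<eta> $ i - e)))
      = (\<Sum>i\<in>UNIV. \<alpha> $ i * (\<sigma> * orbit g (t + l * (\<eta> $ i - e))))"
    by (simp add: sum_distrib_left mult_ac)
  also have "\<dots> \<le> (\<Sum>i\<in>UNIV. \<alpha> $ i * M)"
    by (intro sum_mono mult_left_mono le) (use \<alpha> in \<open>simp add: A_plus_def\<close>)
  also have "\<dots> < 1 * M"
    unfolding sum_distrib_right[symmetric]
    by (rule mult_strict_right_mono) (use \<alpha> \<open>M > 0\<close> in \<open>simp_all add: A_plus_def\<close>)
  also have "1 * M = \<sigma> * orbit g t"
    using \<sigma> by (simp add: M_def orbit_def)
  finally show ?thesis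
    by (simp add: end_bc_def algebra_simps)
qed

lemma end_bc_arc_ends:
  fixes \<alpha> \<eta> :: "real ^ 'm"
  assumes sec: "sector c1 c2 g" and \<alpha>: "\<alpha> \<in> A_plus"
  shows "(-1) ^ j * end_bc e \<alpha> \<eta> g l (time g (real j * pi - pi / 2)) < 0"
    "(-1) ^ j * end_bc e \<alpha> \<eta> g l (time g (real j * pi + pi / 2)) > 0"
proof -
  have j: "(-1 :: real) ^ j \<in> {1, -1}"
    using power_minus1_even by (cases "even j") auto
  have "sin (real j * pi - pi / 2) = - ((-1) ^ j)"
    by (simp add: sin_diff)
  then show "(-1) ^ j * end_bc e \<alpha> \<eta> g l (time g (real j * pi - pi / 2)) < 0"
    using extremal_end_bc[OF sec \<alpha>, of "time g (real j * pi - pi / 2)" "- ((-1) ^ j)"] j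
    by (auto simp: phase_props(2)[OF sec])
  have "sin (real j * pi + pi / 2) = (-1) ^ j"
    by (simp add: sin_add)
  then show "(-1) ^ j * end_bc e \<alpha> \<eta> g l (time g (real j * pi + pi / 2)) > 0"
    using extremal_end_bc[OF sec \<alpha>, of "time g (real j * pi + pi / 2)" "(-1) ^ j"] j
    by (auto simp: phase_props(2)[OF sec])
qed

text \<open>Both the nonlinearity and the half length may vary with \<open>s\<close>, to cover two
  uses: a fixed half-linear \<open>g\<close> with growing length gives half-eigenvalues, and fixed
  length with varying \<open>g\<close> gives the solution. The sign \<open>\<epsilon>\<close> admits
  either orientation of the time defect. The parameter found is strictly inside, so that it can be
  turned into a positive finite energy or length.\<close>

lemma shooting:
  fixes \<alpha>m \<eta>m :: "real ^ 'm" and \<alpha>p \<eta>p :: "real ^ 'n" and g :: "real \<Rightarrow> real \<Rightarrow> real"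
  assumes sec: "\<And>s. s \<in> {0..1} \<Longrightarrow> sector c1 c2 (g s)"
    and g: "continuous_on ({0..1} \<times> UNIV) (\<lambda>(s, x). g s x)"
    and l: "continuous_on {0..1} l"
    and \<alpha>: "\<alpha>m \<in> A_plus" "\<alpha>p \<in> A_plus"
    and at0: "\<And>\<theta> \<phi>. \<theta> \<in> arc j \<Longrightarrow> \<phi> \<in> arc (j + k) \<Longrightarrow>
        end_bc (-1) \<alpha>m \<eta>m (g 0) (l 0) (time (g 0) \<theta>) = 0 \<Longrightarrow>
        end_bc 1 \<alpha>p \<eta>p (g 0) (l 0) (time (g 0) \<phi>) = 0 \<Longrightarrow>
        \<epsilon> * (time (g 0) \<phi> - time (g 0) \<theta> - 2 * l 0) < 0"
    and at1: "\<And>\<theta> \<phi>. \<theta> \<in> arc j \<Longrightarrow> \<phi> \<in> arc (j + k) \<Longrightarrow>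
        end_bc (-1) \<alpha>m \<eta>m (g 1) (l 1) (time (g 1) \<theta>) = 0 \<Longrightarrow>
        end_bc 1 \<alpha>p \<eta>p (g 1) (l 1) (time (g 1) \<phi>) = 0 \<Longrightarrow>
        \<epsilon> * (time (g 1) \<phi> - time (g 1) \<theta> - 2 * l 1) > 0"
    and "\<epsilon> \<noteq> (0 :: real)"
  obtains s t where "0 < s" "s < 1" "phase (g s) t \<in> arc j" "phase (g s) (t + 2 * l s) \<in> arc (j + k)"
    "end_bc (-1) \<alpha>m \<eta>m (g s) (l s) t = 0" "end_bc 1 \<alpha>p \<eta>p (g s) (l s) (t + 2 * l s) = 0"
proof -
  define bc1 bc2 where
    "bc1 s \<theta> = end_bc (-1) \<alpha>m \<eta>m (g s) (l s) (time (g s) \<theta>)" and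
    "bc2 s \<phi> = end_bc 1 \<alpha>p \<eta>p (g s) (l s) (time (g s) \<phi>)" for s \<theta> \<phi>
  define A B C where "A = (\<lambda>(s, \<theta>, \<phi> :: real). (-1) ^ j * bc1 s \<theta>)"
    and "B = (\<lambda>(s, \<theta> :: real, \<phi>). (-1) ^ (j + k) * bc2 s \<phi>)"
    and "C = (\<lambda>(s, \<theta>, \<phi>). \<epsilon> * (time (g s) \<phi> - time (g s) \<theta> - 2 * l s))"
  define a a' b b' where "a = real j * pi - pi / 2" and "a' = real j * pi + pi / 2"
    and "b = real (j + k) * pi - pi / 2" and "b' = real (j + k) * pi + pi / 2"
  let ?U = "{0..1} \<times> (UNIV :: (real \<times> real) set)"
  have time: "continuous_on ?U (\<lambda>p. time (g (fst p)) (h p))" if "continuous_on ?U h" for h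
    by (rule continuous_on_compose_pair[OF time_family[OF sec g] _ that]) (auto intro!: continuous_intros)
  have orb: "continuous_on ?U (\<lambda>p. orbit (g (fst p)) (h p))" if "continuous_on ?U h" for h
    by (rule continuous_on_compose_pair[OF orbit_family[OF sec g] _ that]) (auto intro!: continuous_intros)
  have l': "continuous_on ?U (\<lambda>p. l (fst p))"
    by (rule continuous_on_compose2[OF l]) (auto intro!: continuous_intros)
  have cont: "continuous_on ?U A" "continuous_on ?U B" "continuous_on ?U C"
    unfolding A_def B_def C_def bc1_def bc2_def end_bc_def case_prod_unfold
    by (intro continuous_intros orb time l')+
  have sub: "{0..1} \<times> {a..a'} \<times> {b..b'} \<subseteq> ?U"
    by auto
  have le: "a \<le> a'" "b \<le> b'"
    by (auto simp: a_def a'_def b_def b'_def)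
  have nz: "e1 * z < 0 \<Longrightarrow> z \<noteq> 0" "e1 * z > 0 \<Longrightarrow> z \<noteq> 0" for e1 z :: real
    by auto
  \<comment> \<open>Boundary functions do not vanish at the ends of the closed half turns, so their
    zeros in the box have angles in the open arcs, where \<open>at0\<close> and \<open>at1\<close>
    apply.\<close>
  have sgn: "bc1 s a \<noteq> 0" "bc1 s a' \<noteq> 0" "bc2 s b \<noteq> 0" "bc2 s b' \<noteq> 0" if "s \<in> {0..1}" for s
    unfolding bc1_def bc2_def a_def a'_def b_def b'_def
    by (rule nz(1)[OF end_bc_arc_ends(1)[OF sec[OF that] \<alpha>(1)]]
        nz(2)[OF end_bc_arc_ends(2)[OF sec[OF that] \<alpha>(1)]]
        nz(1)[OF end_bc_arc_ends(1)[OF sec[OF that] \<alpha>(2)]]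
        nz(2)[OF end_bc_arc_ends(2)[OF sec[OF that] \<alpha>(2)]])+
  have arcs: "\<theta> \<in> arc j" "\<phi> \<in> arc (j + k)"
    if "A (s, \<theta>, \<phi>) = 0" "B (s, \<theta>, \<phi>) = 0" "s \<in> {0..1}" "\<theta> \<in> {a..a'}" "\<phi> \<in> {b..b'}" for s \<theta> \<phi>
  proof -
    have "bc1 s \<theta> = 0" "bc2 s \<phi> = 0"
      using that(1,2) by (simp_all add: A_def B_def)
    then have "\<theta> \<noteq> a" "\<theta> \<noteq> a'" "\<phi> \<noteq> b" "\<phi> \<noteq> b'"
      using sgn[OF that(3)] by blast+
    then have "a < \<theta>" "\<theta> < a'" "b < \<phi>" "\<phi> < b'"
      using that(4,5) by simp_all
    then show "\<theta> \<in> arc j" "\<phi> \<in> arc (j + k)"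
      by (simp_all add: arc_def a_def a'_def b_def b'_def)
  qed
  obtain s \<theta> \<phi> where s: "0 < s" "s < 1" and \<theta>: "a < \<theta>" "\<theta> < a'" and \<phi>: "b < \<phi>" "\<phi> < b'"
    and zero: "A (s, \<theta>, \<phi>) = 0" "B (s, \<theta>, \<phi>) = 0" "C (s, \<theta>, \<phi>) = 0"
  proof (rule poincare_miranda_3[of a a' b b' A B C, OF le cont[THEN continuous_on_subset, OF sub]])
    fix s x y :: real assume "(s, x, y) \<in> {0..1} \<times> {a..a'} \<times> {b..b'}"
    then have s: "s \<in> {0..1}" by auto
    show "A (s, x, y) < 0" if "x = a"
      using end_bc_arc_ends(1)[OF sec[OF s] \<alpha>(1)] that by (simp add: A_def bc1_def a_def)
    show "A (s, x, y) > 0" if "x = a'"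
      using end_bc_arc_ends(2)[OF sec[OF s] \<alpha>(1)] that by (simp add: A_def bc1_def a'_def)
    show "B (s, x, y) < 0" if "y = b"
      using end_bc_arc_ends(1)[OF sec[OF s] \<alpha>(2), where j = "j + k"] that
      by (simp add: B_def bc2_def b_def)
    show "B (s, x, y) > 0" if "y = b'"
      using end_bc_arc_ends(2)[OF sec[OF s] \<alpha>(2), where j = "j + k"] that
      by (simp add: B_def bc2_def b'_def)
  next
    fix x y assume *: "(0, x, y) \<in> {0..1 :: real} \<times> {a..a'} \<times> {b..b'}" "A (0, x, y) = 0" "B (0, x, y) = 0"
    then show "C (0, x, y) < 0"
      using at0[of x y] arcs[of 0 x y] by (auto simp: A_def B_def C_def bc1_def bc2_def)
  next
    fix x y assume *: "(1, x, y) \<in> {0..1 :: real} \<times> {a..a'} \<times> {b..b'}" "A (1, x, y) = 0" "B (1, x, y) = 0"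
    then show "C (1, x, y) > 0"
      using at1[of x y] arcs[of 1 x y] by (auto simp: A_def B_def C_def bc1_def bc2_def)
  qed
  have s': "s \<in> {0..1}"
    using s by simp
  have eq: "time (g s) \<phi> = time (g s) \<theta> + 2 * l s"
    using zero(3) \<open>\<epsilon> \<noteq> 0\<close> by (simp add: C_def)
  show thesis
  proof (rule that[of s "time (g s) \<theta>", OF s])
    show "phase (g s) (time (g s) \<theta>) \<in> arc j"
      using \<theta> by (simp add: phase_props(2)[OF sec[OF s']] arc_def a_def a'_def)
    show "phase (g s) (time (g s) \<theta> + 2 * l s) \<in> arc (j + k)"
      using \<phi> by (simp add: phase_props(2)[OF sec[OF s']] arc_def b_def b'_def flip: eq)
    show "end_bc (-1) \<alpha>m \<eta>m (g s) (l s) (time (g s) \<theta>) = 0"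
      using zero(1) by (simp add: A_def bc1_def)
    show "end_bc 1 \<alpha>p \<eta>p (g s) (l s) (time (g s) \<theta> + 2 * l s) = 0"
      using zero(2) by (simp add: B_def bc2_def flip: eq)
  qed
qed

section \<open>Half-linear problems\<close>

definition half_linear :: "real \<Rightarrow> real \<Rightarrow> real \<Rightarrow> real" where
  "half_linear a b x = a * max x 0 - b * max (- x) 0"

lemma half_linear_pos_part: "half_linear a b (u x) = a * pos_part u x - b * neg_part u x"
  by (simp add: half_linear_def pos_part_def neg_part_def)

lemma half_linear_diag [simp]: "half_linear a a x = a * x"
  by (simp add: half_linear_def max_def)

lemma half_linear_scale: "R \<ge> 0 \<Longrightarrow> half_linear a b (R * x) = R * half_linear a b x"
  by (cases "x \<ge> 0") (auto simp: half_linear_def max_def mult_le_0_iff zero_le_mult_iff algebra_simps)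

lemma sector_half_linear:
  assumes "0 < c1" "c1 \<le> 1" "1 \<le> c2" "c1 \<le> a" "a \<le> c2" "c1 \<le> b" "b \<le> c2"
  shows "sector c1 c2 (half_linear a b)"
proof -
  have "continuous_on UNIV (half_linear a b)"
    unfolding half_linear_def by (intro continuous_intros)
  moreover have "c1 * x \<le> a * x" "a * x \<le> c2 * x" if "x \<ge> 0" for x
    using assms that by (auto intro: mult_right_mono)
  moreover have "c2 * x \<le> b * x" "b * x \<le> c1 * x" if "x \<le> 0" for x
    using assms that by (auto intro: mult_right_mono_neg)
  moreover have "half_linear a b x = a * x" if "x \<ge> 0" for x
    using that by (simp add: half_linear_def)
  moreover have "half_linear a b x = b * x" if "x \<le> 0" for x
    using that by (simp add: half_linear_def)
  ultimately show ?thesis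
    using assms(1-3) unfolding sector_def by simp
qed

lemma half_linear_lipschitz:
  assumes "a > 0" "b > 0"
  shows "\<bar>half_linear a b x - half_linear a b y\<bar> \<le> (a + b) * \<bar>x - y\<bar>"
proof -
  have "\<bar>half_linear a b x - half_linear a b y\<bar>
      = \<bar>a * (max x 0 - max y 0) - b * (max (- x) 0 - max (- y) 0)\<bar>"
    by (simp add: half_linear_def algebra_simps)
  also have "\<dots> \<le> a * \<bar>max x 0 - max y 0\<bar> + b * \<bar>max (- x) 0 - max (- y) 0\<bar>"
    using assms abs_triangle_ineq4[of "a * (max x 0 - max y 0)" "b * (max (- x) 0 - max (- y) 0)"]
    by (simp add: abs_mult)
  also have "\<dots> \<le> a * \<bar>x - y\<bar> + b * \<bar>x - y\<bar>"
    using assms by (intro add_mono mult_left_mono) auto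
  finally show ?thesis
    by (simp add: algebra_simps)
qed

section \<open>Convexity of the half-linear energy and comparison of end conditions\<close>

context
  fixes a b :: real and g :: "real \<Rightarrow> real"
  assumes ab: "a > 0" "b > 0"
  defines "g \<equiv> half_linear a b"
begin

lemma half_linear_sector: "sector (min 1 (min a b)) (max 1 (max a b)) g"
  unfolding g_def using ab by (intro sector_half_linear) auto

lemma half_linear_energy_coord: "energy_coord g x = (if x \<ge> 0 then sqrt a * x else sqrt b * x)"
proof (cases "x \<ge> 0")
  case True
  have "integral {0..x} g = integral {0..x} (\<lambda>y. a * y)"
    by (intro integral_cong) (simp add: g_def half_linear_def)
  also have "\<dots> = a * (x\<^sup>2 / 2)"
    using ident_has_integral[OF True] by (simp add: integral_unique)
  finally have "2 * primitive g x = a * x\<^sup>2"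
    using primitive_diff[OF sector_integrable[OF half_linear_sector] True] by simp
  then show ?thesis
    using True by (cases "x = 0") (auto simp: energy_coord_def real_sqrt_mult)
next
  case False
  then have le: "x \<le> 0" by simp
  have "integral {x..0} g = integral {x..0} (\<lambda>y. b * y)"
    by (intro integral_cong) (simp add: g_def half_linear_def)
  also have "\<dots> = - (b * (x\<^sup>2 / 2))"
    using ident_has_integral[OF le] by (simp add: integral_unique)
  finally have "2 * primitive g x = b * x\<^sup>2"
    using primitive_diff[OF sector_integrable[OF half_linear_sector] le] by simp
  then show ?thesis
    using False by (auto simp: energy_coord_def real_sqrt_mult)
qed

lemma half_linear_energy_inv_scale:
  assumes "R > 0"
  shows "energy_inv g (R * y) = R * energy_inv g y"
proof -
  have "energy_coord g (R * energy_inv g y) = R * energy_coord g (energy_inv g y)"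
    using assms by (simp add: half_linear_energy_coord zero_le_mult_iff)
  then have "energy_inv g (energy_coord g (R * energy_inv g y)) = energy_inv g (R * y)"
    by (simp add: energy_inv_props(1)[OF half_linear_sector])
  then show ?thesis
    by (simp add: energy_inv_props(2)[OF half_linear_sector])
qed

text \<open>The convexity in usable form: a maximum of two linear functions of
  \<open>x\<close>.\<close>

lemma half_linear_abs_coord: "\<bar>energy_coord g x\<bar> = max (sqrt a * x) (- (sqrt b * x))"
proof (cases "x \<ge> 0")
  case True
  then have "0 \<le> sqrt a * x" "- (sqrt b * x) \<le> 0"
    using ab by auto
  then show ?thesis
    using True by (simp add: half_linear_energy_coord)
next
  case False
  then have "sqrt a * x \<le> 0" "0 \<le> - (sqrt b * x)"
    using ab by (auto simp: mult_le_0_iff)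
  then show ?thesis
    using False by (simp add: half_linear_energy_coord)
qed

text \<open>The level sets of the energy are convex and symmetric in the velocity, so a convex
  combination of orbit points, with velocities replaced by their moduli, that has lost some mass
  lies strictly inside.\<close>

lemma end_bc_velocity:
  fixes \<alpha> \<eta> :: "real ^ 'm"
  assumes \<alpha>: "\<alpha> \<in> A_plus" and bc: "end_bc e \<alpha> \<eta> g l t = 0"
  shows "(\<Sum>i\<in>UNIV. \<alpha> $ i * \<bar>cos (phase g (t + l * (\<eta> $ i - e)))\<bar>) < \<bar>cos (phase g t)\<bar>"
proof -
  define r where "r i = phase g (t + l * (\<eta> $ i - e))" for i
  have nonneg: "\<alpha> $ i \<ge> 0" for i
    using \<alpha> by (simp add: A_plus_def)
  have mass: "(\<Sum>i\<in>UNIV. \<alpha> $ i) < 1"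
    using \<alpha> by (simp add: A_plus_def)
  have sin: "\<bar>sin (phase g r)\<bar> = max (sqrt a * orbit g r) (- (sqrt b * orbit g r))" for r
    using half_linear_abs_coord[of "orbit g r"] by (simp add: orbit_def energy_inv_props(1)[OF half_linear_sector])
  define P Q where "P = (\<Sum>i\<in>UNIV. \<alpha> $ i * \<bar>sin (r i)\<bar>)" and "Q = (\<Sum>i\<in>UNIV. \<alpha> $ i * \<bar>cos (r i)\<bar>)"
  have orb: "orbit g t = (\<Sum>i\<in>UNIV. \<alpha> $ i * orbit g (t + l * (\<eta> $ i - e)))"
    using bc by (simp add: end_bc_def)
  have le: "sqrt a * orbit g q \<le> \<bar>sin (phase g q)\<bar>" "- sqrt b * orbit g q \<le> \<bar>sin (phase g q)\<bar>" for q
    by (simp_all add: sin)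
  \<comment> \<open>Taken for both slopes, sqrt a and - sqrt b, this bounds both branches of the
    maximum, hence the modulus of the sine at \<open>t\<close>, by the average
    \<open>P\<close>.\<close>
  have P: "c * orbit g t \<le> P" if "\<And>q. c * orbit g q \<le> \<bar>sin (phase g q)\<bar>" for c
  proof -
    have "c * orbit g t = (\<Sum>i\<in>UNIV. \<alpha> $ i * (c * orbit g (t + l * (\<eta> $ i - e))))"
      by (subst orb) (simp add: sum_distrib_left mult.left_commute)
    also have "\<dots> \<le> P"
      unfolding P_def r_def by (intro sum_mono mult_left_mono that nonneg)
    finally show ?thesis .
  qed
  have "sqrt a * orbit g t \<le> P" "- sqrt b * orbit g t \<le> P"
    by (rule P[OF le(1)], rule P[OF le(2)])
  then have "\<bar>sin (phase g t)\<bar> \<le> P"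
    by (simp add: sin)
  then have P: "(sin (phase g t))\<^sup>2 \<le> P\<^sup>2"
    by (metis abs_ge_zero power2_abs power_mono)
  have "Q \<ge> 0"
    unfolding Q_def using nonneg by (simp add: sum_nonneg)
  \<comment> \<open>\<open>\<rho>\<close> is the length of (P, Q), an average of unit vectors with
    total weight below 1. Pairing each of them with (P, Q) and using Cauchy-Schwarz gives
    \<open>\<rho> * \<rho> \<le> (\<Sum>i\<in>UNIV. \<alpha> $ i) * \<rho>\<close>, so
    \<open>\<rho> < 1\<close>.\<close>
  define \<rho> where "\<rho> = sqrt (P\<^sup>2 + Q\<^sup>2)"
  have \<rho>: "\<rho> \<ge> 0" "\<rho>\<^sup>2 = P\<^sup>2 + Q\<^sup>2"
    by (auto simp: \<rho>_def)
  have "P * \<bar>sin x\<bar> + Q * \<bar>cos x\<bar> \<le> \<rho>" for x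
  proof -
    have "\<rho>\<^sup>2 = (P * \<bar>sin x\<bar> + Q * \<bar>cos x\<bar>)\<^sup>2 + (P * \<bar>cos x\<bar> - Q * \<bar>sin x\<bar>)\<^sup>2"
    proof -
      have "(P * \<bar>sin x\<bar> + Q * \<bar>cos x\<bar>)\<^sup>2 + (P * \<bar>cos x\<bar> - Q * \<bar>sin x\<bar>)\<^sup>2
          = (P\<^sup>2 + Q\<^sup>2) * (\<bar>sin x\<bar>\<^sup>2 + \<bar>cos x\<bar>\<^sup>2)"
        by algebra
      then show ?thesis
        by (simp add: \<rho>)
    qed
    then have "(P * \<bar>sin x\<bar> + Q * \<bar>cos x\<bar>)\<^sup>2 \<le> \<rho>\<^sup>2"
      by simp
    then show ?thesis
      using \<rho>(1) power2_le_imp_le by blast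
  qed
  then have "(\<Sum>i\<in>UNIV. \<alpha> $ i * (P * \<bar>sin (r i)\<bar> + Q * \<bar>cos (r i)\<bar>)) \<le> (\<Sum>i\<in>UNIV. \<alpha> $ i * \<rho>)"
    using nonneg by (intro sum_mono mult_left_mono)
  moreover have "(\<Sum>i\<in>UNIV. \<alpha> $ i * (P * \<bar>sin (r i)\<bar> + Q * \<bar>cos (r i)\<bar>)) = P * P + Q * Q"
    unfolding P_def[symmetric] Q_def[symmetric] distrib_left sum.distrib mult.left_commute[of "\<alpha> $ _"]
      sum_distrib_left[symmetric] by (simp add: P_def Q_def)
  ultimately have "\<rho> * \<rho> \<le> (\<Sum>i\<in>UNIV. \<alpha> $ i) * \<rho>"
    using \<rho>(2) by (simp add: power2_eq_square sum_distrib_right)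
  then have "\<rho> < 1"
    using mass \<rho>(1) by (cases "\<rho> = 0") (auto simp: mult_le_cancel_right)
  then have "P\<^sup>2 + Q\<^sup>2 < 1"
    using \<rho> by (metis abs_of_nonneg abs_square_less_1)
  \<comment> \<open>The sine at \<open>t\<close> is at most \<open>P\<close> in modulus, so the
    strict loss of length must appear in the cosine.\<close>
  then have "Q\<^sup>2 < (cos (phase g t))\<^sup>2"
    using P sin_cos_squared_add[of "phase g t"] by linarith
  then have "Q < \<bar>cos (phase g t)\<bar>"
    by (metis abs_ge_zero power2_abs power_less_imp_less_base)
  then show ?thesis
    by (simp add: Q_def r_def)
qed

lemma phase_arc_between:
  assumes "phase g x \<in> arc j" "phase g y \<in> arc j" "s \<in> {0..1}"
  shows "phase g (x + s * (y - x)) \<in> arc j"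
proof -
  have s: "s * \<bar>y - x\<bar> \<le> \<bar>y - x\<bar>" "0 \<le> s * \<bar>y - x\<bar>"
    using assms(3) by (auto intro: mult_left_le_one_le)
  have "min x y \<le> x + s * (y - x) \<and> x + s * (y - x) \<le> max x y"
  proof (cases "x \<le> y")
    case True
    then show ?thesis using s by simp
  next
    case False
    then have "s * \<bar>y - x\<bar> = - (s * (y - x))" "\<bar>y - x\<bar> = - (y - x)"
      by (simp_all add: algebra_simps)
    then show ?thesis using s False unfolding min_def max_def by auto
  qed
  then have "phase g (min x y) \<le> phase g (x + s * (y - x))" "phase g (x + s * (y - x)) \<le> phase g (max x y)"
    using strict_mono_less_eq[OF phase_props(3)[OF half_linear_sector]] by auto
  then show ?thesis
    using assms(1,2) by (auto simp: arc_def min_def max_def split: if_splits)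
qed

text \<open>Moving the midpoint and the half length of the interval linearly, the boundary
  function at the end \<open>e\<close> can only cross zero in one direction.\<close>

lemma end_bc_comparison:
  fixes \<alpha> \<eta> :: "real ^ 'm"
  assumes \<alpha>: "\<alpha> \<in> A_plus" and \<eta>: "\<And>i. \<eta> $ i \<in> {-1<..<1}" and e: "e \<in> {1, -1}" and "l < l'"
    and arcs: "phase g (m + e * l) \<in> arc j" "phase g (m' + e * l') \<in> arc j"
    and bc: "end_bc e \<alpha> \<eta> g l (m + e * l) = 0" "end_bc e \<alpha> \<eta> g l' (m' + e * l') = 0"
  shows "e * (m' - m) < 0"
proof (rule ccontr)
  assume neg: "\<not> e * (m' - m) < 0"
  define dm dl where "dm = m' - m" and "dl = l' - l"
  define M L where "M s = m + s * dm" and "L s = l + s * dl" for s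
  \<comment> \<open>Under the negated claim the shift of the midpoint and the growth of the length
    both push the end \<open>e\<close> outwards. Its speed is then
    \<open>\<bar>dm\<bar> + dl\<close>, which bounds the speed of each interior point.\<close>
  have dm: "e * dm = \<bar>dm\<bar>" and dl: "dl > 0"
    using neg e \<open>l < l'\<close> by (auto simp: dm_def dl_def)
  \<comment> \<open>This sign makes the contribution of the end point to the derivative positive; by
    \<open>end_bc_velocity\<close> it outweighs the others at every zero of
    \<open>p\<close>.\<close>
  define \<kappa> where "\<kappa> = e * (-1) ^ j"
  define p where "p s = \<kappa> * (orbit g (M s + e * L s) - (\<Sum>i\<in>UNIV. \<alpha> $ i * orbit g (M s + L s * \<eta> $ i)))" for s
  define p' where "p' s = \<kappa> * (cos (phase g (M s + e * L s)) * (dm + e * dl)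
    - (\<Sum>i\<in>UNIV. \<alpha> $ i * (cos (phase g (M s + L s * \<eta> $ i)) * (dm + dl * \<eta> $ i))))" for s
  have p_eq: "p s = \<kappa> * end_bc e \<alpha> \<eta> g (L s) (M s + e * L s)" for s
    by (simp add: p_def end_bc_def algebra_simps)
  have "(p has_real_derivative p' s) (at s)" for s
    unfolding p_def p'_def M_def L_def
    by (rule derivative_eq_intros DERIV_chain2[OF orbit_deriv[OF half_linear_sector]] refl)+
      (simp add: mult_ac)
  moreover have "p' s > 0" if s: "s \<in> {0..1}" "p s = 0" for s
  proof -
    have "\<kappa> \<noteq> 0"
      using e by (auto simp: \<kappa>_def)
    then have "end_bc e \<alpha> \<eta> g (L s) (M s + e * L s) = 0"
      using s(2) by (simp add: p_eq)
    from end_bc_velocity[OF \<alpha> this]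
    have vel: "(\<Sum>i\<in>UNIV. \<alpha> $ i * \<bar>cos (phase g (M s + L s * \<eta> $ i))\<bar>) < \<bar>cos (phase g (M s + e * L s))\<bar>"
      by (simp add: algebra_simps)
    have "M s + e * L s = (m + e * l) + s * ((m' + e * l') - (m + e * l))"
      by (simp add: M_def L_def dm_def dl_def algebra_simps)
    then have "phase g (M s + e * L s) \<in> arc j"
      using phase_arc_between[OF arcs s(1)] by simp
    then have "(-1) ^ j * cos (phase g (M s + e * L s)) = \<bar>cos (phase g (M s + e * L s))\<bar>"
      using cos_arc by (cases "even j") force+
    moreover have "e * (dm + e * dl) = \<bar>dm\<bar> + dl"
      using e dm by (auto simp: algebra_simps)
    ultimately have main: "\<kappa> * (cos (phase g (M s + e * L s)) * (dm + e * dl))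
        = \<bar>cos (phase g (M s + e * L s))\<bar> * (\<bar>dm\<bar> + dl)"
      unfolding \<kappa>_def by (metis (no_types, opaque_lifting) mult.assoc mult.left_commute)
    have "\<kappa> * (\<Sum>i\<in>UNIV. \<alpha> $ i * (cos (phase g (M s + L s * \<eta> $ i)) * (dm + dl * \<eta> $ i)))
        \<le> (\<Sum>i\<in>UNIV. \<alpha> $ i * \<bar>cos (phase g (M s + L s * \<eta> $ i))\<bar>) * (\<bar>dm\<bar> + dl)"
      unfolding sum_distrib_left sum_distrib_right
    proof (rule sum_mono)
      fix i
      let ?c = "cos (phase g (M s + L s * \<eta> $ i))"
      have "\<bar>\<kappa>\<bar> = 1"
        using e by (auto simp: \<kappa>_def abs_mult)
      have "\<bar>dl * \<eta> $ i\<bar> \<le> dl"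
        using \<eta>[of i] dl by (simp add: abs_mult mult_le_cancel_left1 abs_le_iff)
      then have d: "\<bar>dm + dl * \<eta> $ i\<bar> \<le> \<bar>dm\<bar> + dl"
        by linarith
      have "\<kappa> * (\<alpha> $ i * (?c * (dm + dl * \<eta> $ i))) \<le> \<bar>\<kappa> * (\<alpha> $ i * (?c * (dm + dl * \<eta> $ i)))\<bar>"
        by (rule abs_ge_self)
      also have "\<dots> = \<alpha> $ i * \<bar>?c\<bar> * \<bar>dm + dl * \<eta> $ i\<bar>"
        using \<alpha> \<open>\<bar>\<kappa>\<bar> = 1\<close> by (simp add: abs_mult A_plus_def)
      also have "\<dots> \<le> \<alpha> $ i * \<bar>?c\<bar> * (\<bar>dm\<bar> + dl)"
        using \<alpha> by (intro mult_left_mono d) (simp add: A_plus_def)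
      finally show "\<kappa> * (\<alpha> $ i * (?c * (dm + dl * \<eta> $ i))) \<le> \<alpha> $ i * \<bar>?c\<bar> * (\<bar>dm\<bar> + dl)" .
    qed
    also have "\<dots> < \<bar>cos (phase g (M s + e * L s))\<bar> * (\<bar>dm\<bar> + dl)"
      using vel dl by (intro mult_strict_right_mono) auto
    finally show ?thesis
      unfolding p'_def right_diff_distrib main by simp
  qed
  moreover have "p 0 = 0" "p 1 = 0"
    unfolding p_eq using bc by (simp_all add: M_def L_def dm_def dl_def)
  ultimately show False
    by (rule same_zero_contradiction)
qed

end

section \<open>Half-eigenvalues: reduction to orbits, comparison, existence and uniqueness\<close>

lemma arc_cases:
  assumes "cos \<phi> \<noteq> 0" "\<phi> > real j * pi - pi / 2"
  obtains i where "\<phi> \<in> arc (j + i)"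
proof -
  define n where "n = \<lfloor>\<phi> / pi + 1 / 2\<rfloor>"
  have "real_of_int n \<le> \<phi> / pi + 1 / 2" "\<phi> / pi + 1 / 2 < real_of_int n + 1"
    unfolding n_def by linarith+
  then have "real_of_int n * pi \<le> (\<phi> / pi + 1 / 2) * pi" "(\<phi> / pi + 1 / 2) * pi < (real_of_int n + 1) * pi"
    by (simp_all only: mult_le_cancel_right_pos mult_less_cancel_right_pos pi_gt_zero)
  moreover have "(\<phi> / pi + 1 / 2) * pi = \<phi> + pi / 2"
    by (simp add: distrib_right)
  ultimately have n: "real_of_int n * pi \<le> \<phi> + pi / 2" "\<phi> + pi / 2 < (real_of_int n + 1) * pi"
    by simp_all
  have "real_of_int n * pi \<noteq> \<phi> + pi / 2"
  proof
    assume "real_of_int n * pi = \<phi> + pi / 2"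
    then have "\<phi> = of_int (n - 1) * pi + pi / 2"
      by (simp add: algebra_simps)
    then show False
      using assms(1) cos_zero_iff_int2 by blast
  qed
  moreover have "int j \<le> n"
  proof -
    have "real_of_int (n + 1) * pi = (real_of_int n + 1) * pi" "real_of_int (int j) * pi = real j * pi"
      by simp_all
    then have "real_of_int (int j) * pi < real_of_int (n + 1) * pi"
      using assms(2) n(2) by linarith
    then have "int j < n + 1"
      by (simp only: mult_less_cancel_right_pos[OF pi_gt_zero] of_int_less_iff)
    then show ?thesis by simp
  qed
  then have "real (j + nat (n - int j)) = real_of_int n"
    by simp
  ultimately have "\<phi> \<in> arc (j + nat (n - int j))"
    using n unfolding arc_def by (auto simp: algebra_simps)
  then show ?thesis
    using that by blast
qed

text \<open>The converse of \<open>orbit_in_T\<close>. A half-linear function is Lipschitz and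
  positively homogeneous, so a multiple of a unit-energy orbit, run at speed sqrt \<mu>, is the only
  solution with the data of \<open>u\<close> at -1.\<close>

lemma half_linear_classification:
  fixes \<alpha>m \<eta>m :: "real ^ 'm" and \<alpha>p \<eta>p :: "real ^ 'n"
  assumes ab: "a > 0" "b > 0" and "\<mu> > 0"
    and u: "u \<in> T \<alpha>m \<eta>m \<alpha>p \<eta>p k ((-1) ^ j)"
    and \<eta>: "\<And>i. \<eta>m $ i \<in> {-1<..<1}" "\<And>i. \<eta>p $ i \<in> {-1<..<1}"
    and ode: "\<And>x. x \<in> {-1<..<1} \<Longrightarrow> - D (D u) x = \<mu> * half_linear a b (u x)"
  defines "g \<equiv> half_linear a b" and "l \<equiv> sqrt \<mu>"
  obtains t where "phase g t \<in> arc j" "phase g (t + 2 * l) \<in> arc (j + k)"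
    "end_bc (-1) \<alpha>m \<eta>m g l t = 0" "end_bc 1 \<alpha>p \<eta>p g l (t + 2 * l) = 0"
proof -
  have hl: "sector (min 1 (min a b)) (max 1 (max a b)) g"
    unfolding g_def by (rule half_linear_sector[OF ab])
  have l: "l > 0" "l\<^sup>2 = \<mu>"
    using \<open>\<mu> > 0\<close> by (auto simp: l_def)
  have u_diff: "u differentiable_on {-1..1}" "D u differentiable_on {-1..1}"
    and u_bc: "u (-1) = (\<Sum>i\<in>UNIV. \<alpha>m $ i * u (\<eta>m $ i))" "u 1 = (\<Sum>i\<in>UNIV. \<alpha>p $ i * u (\<eta>p $ i))"
    and slopes: "D u 1 \<noteq> 0" "(-1) ^ j * D u (-1) > 0"
    and card: "card {x \<in> {-1<..<1}. D u x = 0} = k"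
    using u by (auto simp: T_def X_def C2_def)
  have u_der: "(v has_real_derivative D v x) (at x)"
    if "v differentiable_on {-1..1}" "x \<in> {-1<..<1}" for v x
    using D_within[OF that(1), of x] that(2) by (simp add: at_within_Icc_at)
  define d y0 where "d = D u (-1)" and "y0 = energy_coord g (u (-1))"
  \<comment> \<open>Polar radius of the data at -1, with the slope measured per unit of orbit time;
    it is positive because the slope is not zero.\<close>
  define R where "R = sqrt (y0\<^sup>2 + (d / l)\<^sup>2)"
  have d: "(-1) ^ j * d > 0" "d \<noteq> 0"
    using slopes by (auto simp: d_def)
  have R2: "R\<^sup>2 = y0\<^sup>2 + (d / l)\<^sup>2"
    by (simp add: R_def)
  have "(d / l)\<^sup>2 > 0"
    using d l by simp
  then have "R > 0"
    unfolding R_def by (simp add: add_nonneg_pos)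
  have y2: "1 - (y0 / R)\<^sup>2 = (d / (l * R))\<^sup>2"
  proof -
    have "(y0 / R)\<^sup>2 + (d / (l * R))\<^sup>2 = (y0\<^sup>2 + (d / l)\<^sup>2) / R\<^sup>2"
      by (simp add: power_divide power_mult_distrib add_divide_distrib)
    then show ?thesis
      using \<open>R > 0\<close> by (simp add: R2[symmetric])
  qed
  have "(d / (l * R))\<^sup>2 > 0"
    using d l \<open>R > 0\<close> by simp
  then have "(y0 / R)\<^sup>2 < 1"
    using y2 by linarith
  then have "\<bar>y0 / R\<bar> < 1"
    by (simp add: abs_square_less_1)
  then have y: "-1 < y0 / R" "y0 / R < 1"
    by linarith+
  \<comment> \<open>The factor (-1)^j cancels the sign produced by the shift by j pi, so the sine is
    kept while the cosine takes the sign (-1)^j of the slope.\<close>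
  define \<theta> where "\<theta> = real j * pi + (-1) ^ j * arcsin (y0 / R)"
  have sin\<theta>: "sin \<theta> = y0 / R"
    using y unfolding \<theta>_def sin_add by (cases "even j") auto
  have "cos (arcsin (y0 / R)) = sqrt (1 - (y0 / R)\<^sup>2)"
    using y by (intro cos_arcsin) auto
  also have "\<dots> = \<bar>d\<bar> / (l * R)"
    unfolding y2 using l \<open>R > 0\<close> by (simp add: abs_mult)
  also have "\<bar>d\<bar> = (-1) ^ j * d"
    using d by (cases "even j") auto
  finally have cos\<theta>: "cos \<theta> = d / (l * R)"
    unfolding \<theta>_def cos_add by (cases "even j") auto
  have \<theta>: "\<theta> \<in> arc j"
    using arcsin_lt_bounded[OF y] by (cases "even j") (auto simp: \<theta>_def arc_def)
  define t where "t = time g \<theta>"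
  define \<Phi> where "\<Phi> x = phase g (t + l * (x + 1))" for x
  define w where "w x = R * orbit g (t + l * (x + 1))" for x
  define w' where "w' x = R * l * cos (\<Phi> x)" for x
  have \<Phi>0: "\<Phi> (-1) = \<theta>"
    by (simp add: \<Phi>_def t_def phase_props(2)[OF hl])
  have w: "(w has_real_derivative w' x) (at x)" for x
    unfolding w_def w'_def \<Phi>_def
    by (auto intro!: derivative_eq_intros DERIV_chain2[OF orbit_deriv[OF hl]])
  have w': "(w' has_real_derivative - (\<mu> * g (w x))) (at x)" for x
  proof -
    have "g (w x) = R * g (orbit g (t + l * (x + 1)))"
      unfolding w_def g_def using half_linear_scale[of R] \<open>R > 0\<close> by simp
    then show ?thesis
      unfolding w'_def \<Phi>_def l(2)[symmetric]
      by - (rule derivative_eq_intros DERIV_chain2[OF orbit_deriv2[OF hl]] refl |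
          simp add: power2_eq_square)+
  qed
  have w_cont: "continuous_on S w" "continuous_on S w'" for S
    using w w' DERIV_isCont by (blast intro: continuous_at_imp_continuous_on)+
  have eq: "u x = w x \<and> D u x = w' x" if x: "x \<in> {-1..1}" for x
  proof -
    have "u x - w x = 0 \<and> D u x - w' x = 0"
    proof (rule second_order_unique[where w = "\<lambda>x. u x - w x" and w' = "\<lambda>x. D u x - w' x"
          and w'' = "\<lambda>x. - (\<mu> * (g (u x) - g (w x)))" and K = "\<mu> * (a + b)" and a = "-1" and b = 1])
      show "continuous_on {-1..1} (\<lambda>x. u x - w x)" "continuous_on {-1..1} (\<lambda>x. D u x - w' x)"
        using u_diff[THEN differentiable_imp_continuous_on] w_cont by (auto intro: continuous_on_diff)
      fix z :: real assume z: "z \<in> {-1<..<1}"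
      show "((\<lambda>x. u x - w x) has_real_derivative D u z - w' z) (at z)"
        by (intro DERIV_diff u_der u_diff z w)
      have "D (D u) z = - (\<mu> * g (u z))"
        using ode[OF z] by (simp add: g_def)
      then show "((\<lambda>x. D u x - w' x) has_real_derivative - (\<mu> * (g (u z) - g (w z)))) (at z)"
        using DERIV_diff[OF u_der[OF u_diff(2) z] w'[of z]] by (simp add: algebra_simps)
      show "\<bar>- (\<mu> * (g (u z) - g (w z)))\<bar> \<le> \<mu> * (a + b) * \<bar>u z - w z\<bar>"
        using half_linear_lipschitz[OF ab, of "u z" "w z"] \<open>\<mu> > 0\<close> by (simp add: g_def abs_mult)
    next
      have "w (-1) = R * energy_inv g (y0 / R)"
        by (simp add: w_def orbit_def t_def phase_props(2)[OF hl] sin\<theta>)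
      also have "\<dots> = energy_inv g (R * (y0 / R))"
        unfolding g_def by (rule half_linear_energy_inv_scale[OF ab \<open>R > 0\<close>, symmetric])
      also have "\<dots> = u (-1)"
        using \<open>R > 0\<close> by (simp add: y0_def energy_inv_props(2)[OF hl])
      finally show "u (-1) - w (-1) = 0"
        by simp
      show "D u (-1) - w' (-1) = 0"
        using l \<open>R > 0\<close> by (simp add: w'_def \<Phi>0 cos\<theta> flip: d_def)
    qed (use x ab \<open>\<mu> > 0\<close> in auto)
    then show ?thesis by simp
  qed
  have mono: "strict_mono \<Phi>"
    unfolding \<Phi>_def
    by (intro strict_monoI strict_monoD[OF phase_props(3)[OF hl]]) (use l in simp)
  have cont: "isCont \<Phi> x" for x
    unfolding \<Phi>_def by (intro isCont_o2[OF _ phase_props(4)[OF hl]] continuous_intros)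
  have "cos (\<Phi> 1) \<noteq> 0"
    using slopes(1) eq[of 1] by (auto simp: w'_def)
  moreover have "\<Phi> 1 > real j * pi - pi / 2"
    using strict_monoD[OF mono, of "-1" 1] \<theta> by (simp add: \<Phi>0 arc_def)
  \<comment> \<open>So far the number of half turns is unknown; counting the zeros of u' forces it
    to be \<open>k\<close>.\<close>
  ultimately obtain i where i: "\<Phi> 1 \<in> arc (j + i)"
    using arc_cases by blast
  have "{x \<in> {-1<..<1}. D u x = 0} = {x \<in> {-1<..<1}. cos (\<Phi> x) = 0}"
    using eq l \<open>R > 0\<close> by (auto simp: w'_def)
  then have "i = k"
    using cos_zeros_between_arcs(2)[OF mono cont _ _ i, of "-1"] card \<theta> by (simp add: \<Phi>0)
  have \<eta>': "\<eta>m $ i \<in> {-1..1}" "\<eta>p $ i' \<in> {-1..1}" for i i'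
    using \<eta>(1)[of i] \<eta>(2)[of i'] by auto
  show thesis
  proof (rule that[of t])
    show "phase g t \<in> arc j"
      using \<theta> by (simp add: t_def phase_props(2)[OF hl])
    show "phase g (t + 2 * l) \<in> arc (j + k)"
      using i \<open>i = k\<close> by (simp add: \<Phi>_def mult.commute)
    have "R * orbit g t = R * (\<Sum>i\<in>UNIV. \<alpha>m $ i * orbit g (t + l * (\<eta>m $ i + 1)))"
      using u_bc(1) eq[of "-1"] eq[OF \<eta>'(1)]
      by (simp add: w_def sum_distrib_left mult.left_commute)
    then show "end_bc (-1) \<alpha>m \<eta>m g l t = 0"
      using \<open>R > 0\<close> by (simp add: end_bc_def)
    have "R * orbit g (t + l * 2) = R * (\<Sum>i\<in>UNIV. \<alpha>p $ i * orbit g (t + l * (\<eta>p $ i + 1)))"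
      using u_bc(2) eq[of 1] eq[OF \<eta>'(2)]
      by (simp add: w_def sum_distrib_left mult.left_commute)
    then show "end_bc 1 \<alpha>p \<eta>p g l (t + 2 * l) = 0"
      using \<open>R > 0\<close> by (simp add: end_bc_def algebra_simps)
  qed
qed

text \<open>For a wrong half length \<open>l\<close> the two end conditions prescribe two midpoints,
  \<open>t + l\<close> and \<open>t' - l\<close>. For the eigenfunction both agree with
  \<open>r + sqrt \<mu>\<close>, and the comparison at each end shows that this common midpoint lies
  strictly between the two; their order gives the sign of the time defect.\<close>

lemma half_linear_order:
  fixes \<alpha>m \<eta>m :: "real ^ 'm" and \<alpha>p \<eta>p :: "real ^ 'n"
  assumes ab: "a > 0" "b > 0" and "\<mu> > 0"
    and \<alpha>: "\<alpha>m \<in> A_plus" "\<alpha>p \<in> A_plus"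
    and \<eta>: "\<And>i. \<eta>m $ i \<in> {-1<..<1}" "\<And>i. \<eta>p $ i \<in> {-1<..<1}"
    and u: "u \<in> T \<alpha>m \<eta>m \<alpha>p \<eta>p k ((-1) ^ j)"
    and ode: "\<And>x. x \<in> {-1<..<1} \<Longrightarrow> - D (D u) x = \<mu> * half_linear a b (u x)"
  defines "g \<equiv> half_linear a b"
  assumes arcs: "phase g t \<in> arc j" "phase g t' \<in> arc (j + k)"
    and bc: "end_bc (-1) \<alpha>m \<eta>m g l t = 0" "end_bc 1 \<alpha>p \<eta>p g l t' = 0"
  shows "l < sqrt \<mu> \<Longrightarrow> t' - t > 2 * l" "l > sqrt \<mu> \<Longrightarrow> t' - t < 2 * l"
proof -
  obtain r where r: "phase g r \<in> arc j" "phase g (r + 2 * sqrt \<mu>) \<in> arc (j + k)"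
    "end_bc (-1) \<alpha>m \<eta>m g (sqrt \<mu>) r = 0" "end_bc 1 \<alpha>p \<eta>p g (sqrt \<mu>) (r + 2 * sqrt \<mu>) = 0"
    using half_linear_classification[OF ab \<open>\<mu> > 0\<close> u \<eta> ode] unfolding g_def by blast
  note cmp = end_bc_comparison[OF ab, folded g_def]
  show "t' - t > 2 * l" if "l < sqrt \<mu>"
  proof -
    have "(-1) * ((r + sqrt \<mu>) - (t + l)) < 0"
      by (rule cmp[OF \<alpha>(1) \<eta>(1) _ that]) (use r arcs bc in auto)
    moreover have "1 * ((r + sqrt \<mu>) - (t' - l)) < 0"
      by (rule cmp[OF \<alpha>(2) \<eta>(2) _ that]) (use r arcs bc in \<open>auto simp: algebra_simps\<close>)
    ultimately show ?thesis by simp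
  qed
  show "t' - t < 2 * l" if "l > sqrt \<mu>"
  proof -
    have "(-1) * ((t + l) - (r + sqrt \<mu>)) < 0"
      by (rule cmp[OF \<alpha>(1) \<eta>(1) _ that]) (use r arcs bc in auto)
    moreover have "1 * ((t' - l) - (r + sqrt \<mu>)) < 0"
      by (rule cmp[OF \<alpha>(2) \<eta>(2) _ that]) (use r arcs bc in \<open>auto simp: algebra_simps\<close>)
    ultimately show ?thesis by simp
  qed
qed

lemma sin_zero_arc:
  assumes "sin \<theta> = 0" "\<theta> \<in> arc j"
  shows "\<theta> = real j * pi"
proof -
  obtain n :: int where n: "\<theta> = n * pi"
    using assms(1) sin_zero_iff_int2 by blast
  have eqs: "real_of_int (int j - 1) * pi = real j * pi - pi" "real_of_int (int j + 1) * pi = real j * pi + pi"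
    by (simp_all add: algebra_simps)
  have "real j * pi - pi / 2 < n * pi" "n * pi < real j * pi + pi / 2"
    using assms(2) n by (auto simp: arc_def)
  then have "real_of_int (int j - 1) * pi < n * pi" "n * pi < real_of_int (int j + 1) * pi"
    unfolding eqs using pi_gt_zero by linarith+
  then have "int j - 1 < n" "n < int j + 1"
    by (simp_all only: mult_less_cancel_right_pos[OF pi_gt_zero] of_int_less_iff)
  then have "n = int j"
    by simp
  then show ?thesis
    using n by simp
qed

text \<open>A very short interval leaves too much time between the end angles and a very long one
  too little; shooting in the length finds the match.\<close>

lemma half_linear_existence:
  fixes \<alpha>m \<eta>m :: "real ^ 'm" and \<alpha>p \<eta>p :: "real ^ 'n"
  assumes ab: "a > 0" "b > 0" and "k \<ge> 1"
    and \<alpha>: "\<alpha>m \<in> A_plus" "\<alpha>p \<in> A_plus"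
  obtains \<mu> u where "\<mu> > 0" "u \<in> T \<alpha>m \<eta>m \<alpha>p \<eta>p k ((-1) ^ j)"
    "\<And>x. x \<in> {-1<..<1} \<Longrightarrow> - D (D u) x = \<mu> * half_linear a b (u x)"
proof -
  define g where "g = half_linear a b"
  note sec = half_linear_sector[OF ab, folded g_def]
  define lo hi where "lo = real j * pi - pi / 2" and "hi = real (j + k) * pi + pi / 2"
  \<comment> \<open>The time across all the half turns involved. It exceeds the time between any
    admissible end angles, so an interval of length \<open>2 * L\<close> is certainly too
    long.\<close>
  define L where "L = time g hi - time g lo"
  have inside: "lo < \<theta>" "\<phi> < hi" if "\<theta> \<in> arc j" "\<phi> \<in> arc (j + k)" for \<theta> \<phi>
    using that by (auto simp: arc_def lo_def hi_def)
  have "lo < real j * pi" "real j * pi \<le> real (j + k) * pi" "real (j + k) * pi < hi"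
    by (auto simp: lo_def hi_def intro!: mult_right_mono)
  then have "lo < hi"
    by linarith
  then have "L > 0"
    unfolding L_def using strict_monoD[OF time_strict_mono[OF sec]] by simp
  obtain s t where s: "0 < s" "s < 1" and
    t: "phase g t \<in> arc j" "phase g (t + 2 * (s * L)) \<in> arc (j + k)"
      "end_bc (-1) \<alpha>m \<eta>m g (s * L) t = 0" "end_bc 1 \<alpha>p \<eta>p g (s * L) (t + 2 * (s * L)) = 0"
  proof (rule shooting[of "min 1 (min a b)" "max 1 (max a b)" "\<lambda>_. g" "\<lambda>s. s * L" \<alpha>m \<alpha>p j k \<eta>m \<eta>p "-1"])
    show "continuous_on ({0..1} \<times> UNIV) (\<lambda>(s :: real, x). g x)"
      unfolding case_prod_unfold g_def half_linear_def by (intro continuous_intros)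
    show "continuous_on {0..1} (\<lambda>s. s * L)"
      by (intro continuous_intros)
  next
    fix \<theta> \<phi> assume arcs: "\<theta> \<in> arc j" "\<phi> \<in> arc (j + k)"
      and bc: "end_bc (-1) \<alpha>m \<eta>m g (0 * L) (time g \<theta>) = 0" "end_bc 1 \<alpha>p \<eta>p g (0 * L) (time g \<phi>) = 0"
    \<comment> \<open>At length zero all points coincide with the end, and the condition becomes (1
      - sum of weights) u = 0. Hence the end angles are the centres of their arcs, and these are
      distinct because \<open>k \<ge> 1\<close>.\<close>
    have zero: "sin \<psi> = 0" if "end_bc e \<alpha> \<eta> g (0 * L) (time g \<psi>) = 0" "\<alpha> \<in> A_plus"
      for e \<psi> and \<alpha> \<eta> :: "real ^ 'q"
    proof -
      have "(1 - (\<Sum>i\<in>UNIV. \<alpha> $ i)) * orbit g (time g \<psi>) = 0"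
        using that(1) by (simp add: end_bc_def left_diff_distrib sum_distrib_right)
      then show ?thesis
        using that(2) by (simp add: A_plus_def orbit_def phase_props(2)[OF sec] energy_inv_eq_0_iff[OF sec])
    qed
    have "\<theta> = real j * pi" "\<phi> = real (j + k) * pi"
      using sin_zero_arc zero[OF bc(1) \<alpha>(1)] zero[OF bc(2) \<alpha>(2)] arcs by blast+
    then have "\<theta> < \<phi>"
      using \<open>k \<ge> 1\<close> by simp
    then show "-1 * (time g \<phi> - time g \<theta> - 2 * (0 * L)) < 0"
      using strict_monoD[OF time_strict_mono[OF sec]] by simp
  next
    fix \<theta> \<phi> assume "\<theta> \<in> arc j" "\<phi> \<in> arc (j + k)"
    then have "time g lo < time g \<theta>" "time g \<phi> < time g hi"
      using inside strict_monoD[OF time_strict_mono[OF sec]] by blast+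
    then show "-1 * (time g \<phi> - time g \<theta> - 2 * (1 * L)) > 0"
      using \<open>L > 0\<close> by (simp add: L_def)
  qed (use sec \<alpha> in auto)
  define l where "l = s * L"
  have "l > 0"
    using s \<open>L > 0\<close> by (simp add: l_def)
  note sol = orbit_in_T[OF sec zero_less_one \<open>l > 0\<close> t[folded l_def]]
  show thesis
  proof (rule that[of "l\<^sup>2"])
    show "l\<^sup>2 > 0"
      using \<open>l > 0\<close> by simp
    show "(\<lambda>x. 1 * orbit g (t + l * (x + 1))) \<in> T \<alpha>m \<eta>m \<alpha>p \<eta>p k ((-1) ^ j)"
      by (rule sol(1))
    show "- D (D (\<lambda>x. 1 * orbit g (t + l * (x + 1)))) x
        = l\<^sup>2 * half_linear a b (1 * orbit g (t + l * (x + 1)))" if "x \<in> {-1<..<1}" for x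
      using sol(2)[of x] that by (simp add: g_def)
  qed
qed

text \<open>An orbit for a second eigenvalue has time defect exactly 0 at its own half length, which
  excludes both strict alternatives of \<open>half_linear_order\<close>.\<close>

lemma half_eigenvalue_eqI:
  fixes \<alpha>m \<eta>m :: "real ^ 'm" and \<alpha>p \<eta>p :: "real ^ 'n"
  assumes ab: "a > 0" "b > 0" and \<alpha>: "\<alpha>m \<in> A_plus" "\<alpha>p \<in> A_plus"
    and \<eta>: "\<And>i. \<eta>m $ i \<in> {-1<..<1}" "\<And>i. \<eta>p $ i \<in> {-1<..<1}"
    and \<mu>: "\<mu> > 0" and u: "u \<in> T \<alpha>m \<eta>m \<alpha>p \<eta>p k ((-1) ^ j)"
    and ode: "\<And>x. x \<in> {-1<..<1} \<Longrightarrow> - D (D u) x = \<mu> * half_linear a b (u x)"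
  shows "half_eigenvalue \<alpha>m \<eta>m \<alpha>p \<eta>p k ((-1) ^ j) a b = \<mu>"
  unfolding half_eigenvalue_def half_linear_pos_part[symmetric]
proof (rule the_equality)
  show "\<mu> > 0 \<and> (\<exists>u\<in>T \<alpha>m \<eta>m \<alpha>p \<eta>p k ((-1) ^ j). \<forall>x\<in>{-1<..<1}. - D (D u) x = \<mu> * half_linear a b (u x))"
    using \<mu> u ode by blast
next
  fix \<mu>' assume "\<mu>' > 0 \<and> (\<exists>u\<in>T \<alpha>m \<eta>m \<alpha>p \<eta>p k ((-1) ^ j). \<forall>x\<in>{-1<..<1}. - D (D u) x = \<mu>' * half_linear a b (u x))"
  then obtain v where \<mu>': "\<mu>' > 0" and v: "v \<in> T \<alpha>m \<eta>m \<alpha>p \<eta>p k ((-1) ^ j)"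
    and ode': "\<And>x. x \<in> {-1<..<1} \<Longrightarrow> - D (D v) x = \<mu>' * half_linear a b (v x)"
    by blast
  obtain t where t: "phase (half_linear a b) t \<in> arc j"
    "phase (half_linear a b) (t + 2 * sqrt \<mu>') \<in> arc (j + k)"
    "end_bc (-1) \<alpha>m \<eta>m (half_linear a b) (sqrt \<mu>') t = 0"
    "end_bc 1 \<alpha>p \<eta>p (half_linear a b) (sqrt \<mu>') (t + 2 * sqrt \<mu>') = 0"
    using half_linear_classification[OF ab \<mu>' v \<eta> ode'] by blast
  have "\<not> sqrt \<mu>' < sqrt \<mu>" "\<not> sqrt \<mu>' > sqrt \<mu>"
    using half_linear_order[OF ab \<mu> \<alpha> \<eta> u ode t] by auto
  then show "\<mu>' = \<mu>"
    by simp
qed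

lemma T_uminus:
  fixes \<alpha>m \<eta>m :: "real ^ 'm" and \<alpha>p \<eta>p :: "real ^ 'n"
  assumes u: "u \<in> T \<alpha>m \<eta>m \<alpha>p \<eta>p k \<nu>"
  shows "(\<lambda>x. - u x) \<in> T \<alpha>m \<eta>m \<alpha>p \<eta>p k (- \<nu>)"
    and "\<And>x. x \<in> {-1..1} \<Longrightarrow> D (D (\<lambda>x. - u x)) x = - D (D u) x"
proof -
  have diff: "u differentiable_on {-1..1}" "D u differentiable_on {-1..1}" "continuous_on {-1..1} (D (D u))"
    using u by (auto simp: T_def X_def C2_def)
  have d1: "((\<lambda>x. - u x) has_real_derivative - D u x) (at x within {-1..1})"
    and d2: "((\<lambda>x. - D u x) has_real_derivative - D (D u) x) (at x within {-1..1})"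
    if "x \<in> {-1..1}" for x
    using D_within[OF diff(1) that] D_within[OF diff(2) that] by (auto intro: DERIV_minus)
  have eq: "D (\<lambda>x. - u x) x = - D u x" "D (D (\<lambda>x. - u x)) x = - D (D u) x" if "x \<in> {-1..1}" for x
    using D_of_deriv(1,3)[of "\<lambda>x. - u x" "\<lambda>x. - D u x" "\<lambda>x. - D (D u) x" x] d1 d2 that by blast+
  then show "\<And>x. x \<in> {-1..1} \<Longrightarrow> D (D (\<lambda>x. - u x)) x = - D (D u) x"
    by blast
  have "(\<lambda>x. - u x) \<in> C2"
    by (rule C2_I[OF d1 d2]) (auto intro: continuous_on_minus diff(3))
  then have "(\<lambda>x. - u x) \<in> X \<alpha>m \<eta>m \<alpha>p \<eta>p"
    using u by (simp add: T_def X_def sum_negf)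
  moreover have zeros: "D (\<lambda>x. - u x) x = 0 \<longleftrightarrow> D u x = 0"
    "simple_zero (D (\<lambda>x. - u x)) x \<longleftrightarrow> simple_zero (D u) x" if "x \<in> {-1<..<1}" for x
    using eq[of x] that by (auto simp: simple_zero_def)
  moreover have "{x \<in> {-1<..<1}. D (\<lambda>x. - u x) x = 0} = {x \<in> {-1<..<1}. D u x = 0}"
    using zeros by blast
  moreover have "(\<forall>z\<in>{x<..<y}. D (\<lambda>x. - u x) z \<noteq> 0) \<longleftrightarrow> (\<forall>z\<in>{x<..<y}. D u z \<noteq> 0)"
    if "x \<in> {-1<..<1}" "y \<in> {-1<..<1}" for x y
    using zeros that by auto
  ultimately show "(\<lambda>x. - u x) \<in> T \<alpha>m \<eta>m \<alpha>p \<eta>p k (- \<nu>)"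
    using u eq[of "-1"] eq[of 1] unfolding T_def by simp
qed

text \<open>Puts the linear factor of the hypothesis into half-linear form. The equation is odd, so
  a reflected eigenfunction serves the other sign, and the coefficient \<open>c\<close> is absorbed
  by dividing the eigenvalue.\<close>

lemma eigenvalue_half_eigenvalue:
  fixes \<alpha>m \<eta>m :: "real ^ 'm" and \<alpha>p \<eta>p :: "real ^ 'n"
  assumes "c > 0" "k \<ge> 1" and \<alpha>: "\<alpha>m \<in> A_plus" "\<alpha>p \<in> A_plus"
    and \<eta>: "\<And>i. \<eta>m $ i \<in> {-1<..<1}" "\<And>i. \<eta>p $ i \<in> {-1<..<1}" and "j \<le> 1"
  shows "half_eigenvalue \<alpha>m \<eta>m \<alpha>p \<eta>p k ((-1) ^ j) c c = eigenvalue \<alpha>m \<eta>m \<alpha>p \<eta>p k / c"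
proof -
  obtain \<mu> u where \<mu>: "\<mu> > 0" and u: "u \<in> T \<alpha>m \<eta>m \<alpha>p \<eta>p k ((-1) ^ 0)"
    and ode: "\<And>x. x \<in> {-1<..<1} \<Longrightarrow> - D (D u) x = \<mu> * half_linear 1 1 (u x)"
    using half_linear_existence[of 1 1 k \<alpha>m \<alpha>p \<eta>m \<eta>p 0] \<open>k \<ge> 1\<close> \<alpha> by auto
  have "eigenvalue \<alpha>m \<eta>m \<alpha>p \<eta>p k = \<mu>"
    using half_eigenvalue_eqI[OF _ _ \<alpha> \<eta> \<mu> u ode] by (simp add: eigenvalue_def)
  moreover have "half_eigenvalue \<alpha>m \<eta>m \<alpha>p \<eta>p k ((-1) ^ j) c c = \<mu> / c"
  proof (cases "j = 0")
    case True
    show ?thesis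
      by (rule half_eigenvalue_eqI[OF \<open>c > 0\<close> \<open>c > 0\<close> \<alpha> \<eta>, where u = u])
        (use \<mu> \<open>c > 0\<close> u ode True in auto)
  next
    case False
    then have "j = 1"
      using \<open>j \<le> 1\<close> by simp
    then have "(\<lambda>x. - u x) \<in> T \<alpha>m \<eta>m \<alpha>p \<eta>p k ((-1) ^ j)"
      using T_uminus(1)[OF u] by simp
    then show ?thesis
      by (rule half_eigenvalue_eqI[OF \<open>c > 0\<close> \<open>c > 0\<close> \<alpha> \<eta>, rotated])
        (use \<mu> \<open>c > 0\<close> ode T_uminus(2)[OF u] in \<open>auto simp: minus_equation_iff\<close>)
  qed
  ultimately show ?thesis
    by simp
qed

lemma half_eigenvalue_order:
  fixes \<alpha>m \<eta>m :: "real ^ 'm" and \<alpha>p \<eta>p :: "real ^ 'n"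
  assumes ab: "a > 0" "b > 0" and "k \<ge> 1"
    and \<alpha>: "\<alpha>m \<in> A_plus" "\<alpha>p \<in> A_plus"
    and \<eta>: "\<And>i. \<eta>m $ i \<in> {-1<..<1}" "\<And>i. \<eta>p $ i \<in> {-1<..<1}"
  defines "g \<equiv> half_linear a b"
  assumes arcs: "\<theta> \<in> arc j" "\<phi> \<in> arc (j + k)"
    and bc: "end_bc (-1) \<alpha>m \<eta>m g 1 (time g \<theta>) = 0" "end_bc 1 \<alpha>p \<eta>p g 1 (time g \<phi>) = 0"
  shows "half_eigenvalue \<alpha>m \<eta>m \<alpha>p \<eta>p k ((-1) ^ j) a b > 1 \<Longrightarrow> time g \<phi> - time g \<theta> > 2"
    "half_eigenvalue \<alpha>m \<eta>m \<alpha>p \<eta>p k ((-1) ^ j) a b < 1 \<Longrightarrow> time g \<phi> - time g \<theta> < 2"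
proof -
  obtain \<mu> u where \<mu>: "\<mu> > 0" and u: "u \<in> T \<alpha>m \<eta>m \<alpha>p \<eta>p k ((-1) ^ j)"
    and ode: "\<And>x. x \<in> {-1<..<1} \<Longrightarrow> - D (D u) x = \<mu> * half_linear a b (u x)"
    using half_linear_existence[OF ab \<open>k \<ge> 1\<close> \<alpha>] by blast
  have "half_eigenvalue \<alpha>m \<eta>m \<alpha>p \<eta>p k ((-1) ^ j) a b = \<mu>"
    by (rule half_eigenvalue_eqI[OF ab \<alpha> \<eta> \<mu> u ode])
  moreover have "phase g (time g \<theta>) \<in> arc j" "phase g (time g \<phi>) \<in> arc (j + k)"
    using arcs phase_props(2)[OF half_linear_sector[OF ab]] by (simp_all add: g_def)
  note order = half_linear_order[OF ab \<mu> \<alpha> \<eta> u ode, folded g_def, OF _ this bc]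
  ultimately show "half_eigenvalue \<alpha>m \<eta>m \<alpha>p \<eta>p k ((-1) ^ j) a b > 1 \<Longrightarrow> time g \<phi> - time g \<theta> > 2"
    "half_eigenvalue \<alpha>m \<eta>m \<alpha>p \<eta>p k ((-1) ^ j) a b < 1 \<Longrightarrow> time g \<phi> - time g \<theta> < 2"
    using order by auto
qed

section \<open>Rescaling the nonlinearity\<close>

lemma bounded_between_positive:
  fixes r :: "real \<Rightarrow> real"
  assumes cont: "continuous_on UNIV r" and pos: "\<And>x. r x > 0"
    and lim: "(r \<longlongrightarrow> p) at_top" "(r \<longlongrightarrow> q) at_bot" and "p > 0" "q > 0"
  obtains c1 c2 where "c1 > 0" "\<And>x. c1 \<le> r x" "\<And>x. r x \<le> c2"
proof -
  have "eventually (\<lambda>x. p / 2 < r x \<and> r x < 2 * p) at_top"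
    using order_tendstoD(1)[OF lim(1), of "p / 2"] order_tendstoD(2)[OF lim(1), of "2 * p"] \<open>p > 0\<close>
    by (intro eventually_conj) auto
  then obtain N where N: "\<And>x. x \<ge> N \<Longrightarrow> p / 2 < r x \<and> r x < 2 * p"
    by (auto simp: eventually_at_top_linorder)
  have "eventually (\<lambda>x. q / 2 < r x \<and> r x < 2 * q) at_bot"
    using order_tendstoD(1)[OF lim(2), of "q / 2"] order_tendstoD(2)[OF lim(2), of "2 * q"] \<open>q > 0\<close>
    by (intro eventually_conj) auto
  then obtain M where M: "\<And>x. x \<le> M \<Longrightarrow> q / 2 < r x \<and> r x < 2 * q"
    by (auto simp: eventually_at_bot_linorder)
  \<comment> \<open>The point 0 keeps \<open>K\<close> nonempty when \<open>M > N\<close>.\<close>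
  define K where "K = insert 0 {M..N}"
  have K: "compact K" "K \<noteq> {}"
    by (auto simp: K_def)
  have cK: "continuous_on K r"
    using cont continuous_on_subset by blast
  obtain x1 where x1: "\<And>x. x \<in> K \<Longrightarrow> r x1 \<le> r x"
    using continuous_attains_inf[OF K cK] by blast
  obtain x2 where x2: "\<And>x. x \<in> K \<Longrightarrow> r x \<le> r x2"
    using continuous_attains_sup[OF K cK] by blast
  show thesis
  proof (rule that[of "min (r x1) (min (p / 2) (q / 2))" "max (r x2) (max (2 * p) (2 * q))"])
    show "min (r x1) (min (p / 2) (q / 2)) > 0"
      using pos \<open>p > 0\<close> \<open>q > 0\<close> by simp
    fix x
    consider "x \<le> M" | "x \<ge> N" | "x \<in> K"
      by (force simp: K_def)
    then have "(r x1 \<le> r x \<or> p / 2 \<le> r x \<or> q / 2 \<le> r x) \<and> (r x \<le> r x2 \<or> r x \<le> 2 * p \<or> r x \<le> 2 * q)"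
    proof cases
      case 1
      then show ?thesis using M[of x] by simp
    next
      case 2
      then show ?thesis using N[of x] by simp
    next
      case 3
      then show ?thesis using x1[of x] x2[of x] by simp
    qed
    then show "min (r x1) (min (p / 2) (q / 2)) \<le> r x" "r x \<le> max (r x2) (max (2 * p) (2 * q))"
      by (auto simp: min_le_iff_disj le_max_iff_disj)
  qed
qed

lemma eventually_blowup:
  fixes r :: "real \<Rightarrow> real"
  assumes lim: "((\<lambda>z. r (\<sigma> * z)) \<longlongrightarrow> L) at_top" and \<sigma>: "\<sigma> * \<sigma> = 1" "\<sigma> * x0 > 0" and "\<epsilon> > 0"
  shows "eventually (\<lambda>p. fst p < 1 \<longrightarrow> dist (r (fst p / (1 - fst p) * snd p)) L < \<epsilon>) (nhds (1, x0))"
proof -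
  obtain Z0 where Z0: "\<And>z. z \<ge> Z0 \<Longrightarrow> dist (r (\<sigma> * z)) L < \<epsilon>"
    using tendstoD[OF lim \<open>\<epsilon> > 0\<close>] by (auto simp: eventually_at_top_linorder)
  \<comment> \<open>\<open>\<delta>\<close> bounds \<bar>x\<bar> from below near \<open>x0\<close>,
    and an amplification above \<open>K\<close> then carries the argument beyond \<open>Z0\<close>.
    The parameter with s/(1-s) = K is K/(1+K), the threshold used below.\<close>
  define \<delta> K where "\<delta> = \<sigma> * x0 / 2" and "K = max 1 (Z0 / \<delta>)"
  have "\<delta> > 0" "K > 0"
    using \<sigma> by (auto simp: \<delta>_def K_def)
  have lims: "((\<lambda>p. \<sigma> * snd p) \<longlongrightarrow> \<sigma> * x0) (nhds (1 :: real, x0))" "(fst \<longlongrightarrow> 1) (nhds (1 :: real, x0))"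
    by (auto intro!: tendsto_eq_intros filterlim_ident)
  have "\<delta> < \<sigma> * x0" "K / (1 + K) < 1"
    using \<sigma> \<open>K > 0\<close> by (simp_all add: \<delta>_def)
  from order_tendstoD(1)[OF lims(1) this(1)] order_tendstoD(1)[OF lims(2) this(2)]
  have "eventually (\<lambda>p. \<sigma> * snd p > \<delta>) (nhds (1 :: real, x0))"
    "eventually (\<lambda>p. fst p > K / (1 + K)) (nhds (1 :: real, x0))"
    by simp_all
  then show ?thesis
  proof eventually_elim
    case (elim p)
    show ?case
    proof
      assume "fst p < 1"
      then have R: "fst p / (1 - fst p) > K"
        using elim(2) \<open>K > 0\<close> by (simp add: field_simps)
      have "Z0 \<le> K * \<delta>"
        using \<open>\<delta> > 0\<close> by (simp add: K_def max_def field_simps)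
      also have "\<dots> \<le> fst p / (1 - fst p) * (\<sigma> * snd p)"
        using R elim(1) \<open>\<delta> > 0\<close> \<open>K > 0\<close> by (intro mult_mono) auto
      finally have "dist (r (\<sigma> * (fst p / (1 - fst p) * (\<sigma> * snd p)))) L < \<epsilon>"
        by (rule Z0)
      moreover have "\<sigma> * (R * (\<sigma> * x)) = R * x" for R x
        using \<sigma>(1) by (metis mult.assoc mult.left_commute mult_1)
      ultimately show "dist (r (fst p / (1 - fst p) * snd p)) L < \<epsilon>"
        by simp
    qed
  qed
qed

text \<open>With f(x) = x r(x) and R = s/(1-s) this is f(Rx)/R, with the division by R already
  carried out; so s = 0 is covered by the same formula and gives r(0) x.\<close>

definition rescaled :: "(real \<Rightarrow> real) \<Rightarrow> real \<Rightarrow> real \<Rightarrow> real \<Rightarrow> real \<Rightarrow> real" where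
  "rescaled r p q s x = (if s = 1 then half_linear p q x else x * r (s / (1 - s) * x))"

lemma rescaled_sector:
  assumes cont: "continuous_on UNIV r" and r: "\<And>x. c1 \<le> r x" "\<And>x. r x \<le> c2"
    and c: "0 < c1" "c1 \<le> 1" "1 \<le> c2" "c1 \<le> p" "p \<le> c2" "c1 \<le> q" "q \<le> c2"
  shows "sector c1 c2 (rescaled r p q s)"
proof (cases "s = 1")
  case True
  then show ?thesis
    using sector_half_linear[OF c] by (simp add: rescaled_def[abs_def] del: half_linear_diag)
next
  case False
  have "continuous_on UNIV (\<lambda>x. r (s / (1 - s) * x))"
    by (rule continuous_on_compose2[OF cont]) (use False in \<open>auto intro!: continuous_intros\<close>)
  then have "continuous_on UNIV (\<lambda>x. x * r (s / (1 - s) * x))"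
    by (intro continuous_intros)
  moreover have "c1 * x \<le> x * r y" "x * r y \<le> c2 * x" if "x \<ge> 0" for x y
    using mult_right_mono[OF r(1) that] mult_right_mono[OF r(2) that] by (simp_all add: mult.commute)
  moreover have "c2 * x \<le> x * r y" "x * r y \<le> c1 * x" if "x \<le> 0" for x y
    using mult_right_mono_neg[OF r(1) that] mult_right_mono_neg[OF r(2) that] by (simp_all add: mult.commute)
  ultimately show ?thesis
    using False c(1-3) unfolding sector_def rescaled_def by auto
qed

lemma rescaled_continuous:
  assumes cont: "continuous_on UNIV r" and r: "\<And>x. c1 \<le> r x" "\<And>x. r x \<le> c2"
    and c: "0 < c1" "c1 \<le> 1" "1 \<le> c2" "c1 \<le> p" "p \<le> c2" "c1 \<le> q" "q \<le> c2"
    and lim: "(r \<longlongrightarrow> p) at_top" "(r \<longlongrightarrow> q) at_bot"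
  shows "continuous_on ({0..1} \<times> UNIV) (\<lambda>(s, x). rescaled r p q s x)"
proof -
  have "((\<lambda>z. rescaled r p q (fst z) (snd z)) \<longlongrightarrow> rescaled r p q s x) (at (s, x) within {0..1} \<times> UNIV)"
    if s: "s \<in> {0..1}" for s x
  proof -
    let ?F = "at (s, x) within {0..1} \<times> UNIV"
    have proj: "(fst \<longlongrightarrow> s) ?F" "(snd \<longlongrightarrow> x) ?F"
      by (auto intro!: tendsto_eq_intros)
    have in01: "eventually (\<lambda>z. fst z \<in> {0..1}) ?F"
      unfolding eventually_at_topological by (intro exI[of _ UNIV]) auto
    consider "s < 1" | "s = 1" "x = 0" | "s = 1" "x \<noteq> 0"
      using s by force
    then show ?thesis
    proof cases
      case 1
      have rc: "isCont r y" for y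
        using cont by (simp add: continuous_on_eq_continuous_at)
      have "((\<lambda>z. fst z / (1 - fst z) * snd z) \<longlongrightarrow> s / (1 - s) * x) ?F"
        by (intro tendsto_mult tendsto_divide tendsto_diff tendsto_const proj) (use 1 in simp)
      from tendsto_mult[OF proj(2) isCont_tendsto_compose[OF rc this]]
      have "((\<lambda>z. snd z * r (fst z / (1 - fst z) * snd z)) \<longlongrightarrow> x * r (s / (1 - s) * x)) ?F" .
      moreover have "eventually (\<lambda>z. fst z < 1) ?F"
        using order_tendstoD(2)[OF proj(1) 1] .
      then have "eventually (\<lambda>z. snd z * r (fst z / (1 - fst z) * snd z) = rescaled r p q (fst z) (snd z)) ?F"
        by eventually_elim (simp add: rescaled_def)
      ultimately have "((\<lambda>z. rescaled r p q (fst z) (snd z)) \<longlongrightarrow> x * r (s / (1 - s) * x)) ?F"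
        by (rule Lim_transform_eventually)
      then show ?thesis
        using 1 by (simp add: rescaled_def)
    next
      case 2
      \<comment> \<open>Near (1, 0) the argument of \<open>r\<close> has no limit; only the linear
        bound, uniform in the parameter, controls the value.\<close>
      have "\<bar>rescaled r p q s' y\<bar> \<le> c2 * \<bar>y\<bar>" for s' y
        by (rule sector_abs_bounds(2)[OF rescaled_sector[OF cont r c]])
      then have "eventually (\<lambda>z. norm (rescaled r p q (fst z) (snd z)) \<le> c2 * \<bar>snd z\<bar>) ?F"
        by (intro always_eventually) simp
      moreover have "(snd \<longlongrightarrow> 0) ?F"
        using 2 proj(2) by simp
      then have "((\<lambda>z. c2 * \<bar>snd z\<bar>) \<longlongrightarrow> 0) ?F"
        by (intro tendsto_mult_right_zero tendsto_rabs_zero)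
      ultimately have "((\<lambda>z. rescaled r p q (fst z) (snd z)) \<longlongrightarrow> 0) ?F"
        by (rule Lim_null_comparison)
      then show ?thesis
        using 2 by (simp add: rescaled_def half_linear_def)
    next
      case 3
      define \<sigma> where "\<sigma> = sgn x"
      define L where "L = (if x > 0 then p else q)"
      have \<sigma>: "\<sigma> * \<sigma> = 1" "\<sigma> * x > 0"
        using 3 by (auto simp: \<sigma>_def sgn_if)
      have lim': "((\<lambda>z. r (\<sigma> * z)) \<longlongrightarrow> L) at_top"
        using 3 lim by (auto simp: \<sigma>_def L_def sgn_if filterlim_at_bot_mirror)
      \<comment> \<open>The quotient of the rescaled function by \<open>x\<close>, near a point with
        x \<noteq> 0; its value \<open>L\<close> at parameter 1 is the limit of \<open>r\<close> on
        the relevant side.\<close>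
      define Q where "Q z = (if fst z = 1 then L else r (fst z / (1 - fst z) * snd z))" for z :: "real \<times> real"
      have "(Q \<longlongrightarrow> L) ?F"
      proof (rule tendstoI)
        fix \<epsilon> :: real assume "\<epsilon> > 0"
        then have "eventually (\<lambda>z. fst z < 1 \<longrightarrow> dist (r (fst z / (1 - fst z) * snd z)) L < \<epsilon>) ?F"
          unfolding 3(1) by (rule filter_leD[OF at_within_le_nhds eventually_blowup[OF lim' \<sigma>]])
        then show "eventually (\<lambda>z. dist (Q z) L < \<epsilon>) ?F"
          using in01 by eventually_elim (use \<open>\<epsilon> > 0\<close> in \<open>auto simp: Q_def\<close>)
      qed
      then have "((\<lambda>z. snd z * Q z) \<longlongrightarrow> x * L) ?F"
        by (intro tendsto_mult proj(2))
      moreover have "eventually (\<lambda>z. \<sigma> * snd z > 0) ?F"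
        by (rule order_tendstoD(1)[OF tendsto_mult[OF tendsto_const proj(2)] \<sigma>(2)])
      then have "eventually (\<lambda>z. snd z * Q z = rescaled r p q (fst z) (snd z)) ?F"
        by eventually_elim
          (auto simp: Q_def rescaled_def L_def \<sigma>_def sgn_if half_linear_def zero_less_mult_iff split: if_splits)
      ultimately have "((\<lambda>z. rescaled r p q (fst z) (snd z)) \<longlongrightarrow> x * L) ?F"
        by (rule Lim_transform_eventually)
      moreover have "x * L = rescaled r p q s x"
        using 3 by (auto simp: rescaled_def L_def half_linear_def)
      ultimately show ?thesis
        by simp
    qed
  qed
  then show ?thesis
    unfolding continuous_on_def by (auto simp: case_prod_unfold)
qed

theorem theorem8p2:
  fixes \<alpha>m \<eta>m :: "real ^ 'm" and \<alpha>p \<eta>p :: "real ^ 'n"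
    and f :: "real \<Rightarrow> real" and f_inf f_minf f0 \<nu> :: real and k :: nat
  assumes "\<alpha>m \<in> A_plus" and "\<alpha>p \<in> A_plus"
    and "\<And>i. \<eta>m $ i \<in> {-1<..<1}" and "\<And>i. \<eta>p $ i \<in> {-1<..<1}"
    and "continuous_on UNIV f"
    and "((\<lambda>s. f s / s) \<longlongrightarrow> f_inf) at_top" and "f_inf > 0"
    and "((\<lambda>s. f s / s) \<longlongrightarrow> f_minf) at_bot" and "f_minf > 0"
    and "f 0 = 0"
    and "((\<lambda>s. f s / s) \<longlongrightarrow> f0) (at 0)" and "f0 > 0"
    and "\<And>s. s \<noteq> 0 \<Longrightarrow> s * f s > 0"
    and "k \<ge> 1" and "\<nu> \<in> {-1, 1}"
    and "(eigenvalue \<alpha>m \<eta>m \<alpha>p \<eta>p k / f0 - 1) *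
         (half_eigenvalue \<alpha>m \<eta>m \<alpha>p \<eta>p k \<nu> f_inf f_minf - 1) < 0"
  shows "\<exists>u\<in>T \<alpha>m \<eta>m \<alpha>p \<eta>p k \<nu>. \<forall>x\<in>{-1<..<1}. - D (D u) x = f (u x)"
proof -
  note \<alpha> = assms(1,2) and \<eta> = assms(3,4)
  \<comment> \<open>The value \<open>f0\<close> at 0 makes the quotient f(s)/s continuous on the
    whole line.\<close>
  define r where "r s = (if s = 0 then f0 else f s / s)" for s
  have f_r: "f s = s * r s" for s
    using \<open>f 0 = 0\<close> by (simp add: r_def)
  have r_pos: "r s > 0" for s
    using assms(13)[of s] \<open>f0 > 0\<close> by (auto simp: r_def zero_less_mult_iff zero_less_divide_iff)
  have "eventually (\<lambda>s. f s / s = r s) at_top"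
    using eventually_gt_at_top[of 0] by eventually_elim (simp add: r_def)
  moreover have "eventually (\<lambda>s. f s / s = r s) at_bot"
    using eventually_gt_at_bot[of 0] by eventually_elim (simp add: r_def)
  ultimately have r_lim: "(r \<longlongrightarrow> f_inf) at_top" "(r \<longlongrightarrow> f_minf) at_bot"
    using Lim_transform_eventually assms(6,8) by blast+
  have "isCont r s" for s
  proof (cases "s = 0")
    case True
    have "(r \<longlongrightarrow> f0) (at 0)"
      using assms(11) by (rule Lim_transform_eventually) (auto simp: r_def eventually_at_filter)
    then show ?thesis
      using True by (simp add: isCont_def r_def)
  next
    case False
    have "isCont (\<lambda>s. f s / s) s"
      using False assms(5) by (intro continuous_intros) (auto simp: continuous_on_eq_continuous_at)
    moreover have "eventually (\<lambda>s. s \<in> - {0}) (nhds s)"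
      using False by (intro eventually_nhds_in_open) auto
    then have "eventually (\<lambda>s. f s / s = r s) (nhds s)"
      by eventually_elim (simp add: r_def)
    ultimately show ?thesis
      using isCont_cong[of "\<lambda>s. f s / s" r s] by simp
  qed
  then have r_cont: "continuous_on UNIV r"
    by (simp add: continuous_on_eq_continuous_at)
  obtain b1 b2 where b: "b1 > 0" "\<And>s. b1 \<le> r s" "\<And>s. r s \<le> b2"
    using bounded_between_positive[OF r_cont r_pos r_lim assms(7,9)] by blast
  define c1 c2 where "c1 = min b1 (min 1 (min f_inf f_minf))" and "c2 = max b2 (max 1 (max f_inf f_minf))"
  have c: "0 < c1" "c1 \<le> 1" "1 \<le> c2" "c1 \<le> f_inf" "f_inf \<le> c2" "c1 \<le> f_minf" "f_minf \<le> c2"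
    using b(1) assms(7,9) by (auto simp: c1_def c2_def)
  have r_bounds: "c1 \<le> r s" "r s \<le> c2" for s
    using b(2,3)[of s] by (auto simp: c1_def c2_def)
  define g where "g = rescaled r f_inf f_minf"
  have sec: "sector c1 c2 (g s)" for s
    unfolding g_def by (rule rescaled_sector[OF r_cont r_bounds c])
  have g0: "g 0 = half_linear f0 f0"
    by (rule ext) (simp add: g_def rescaled_def r_def)
  have g1: "g 1 = half_linear f_inf f_minf"
    by (rule ext) (simp add: g_def rescaled_def)
  \<comment> \<open>The sign \<nu> as a starting half turn: the initial angle lies around 0 or
    around pi.\<close>
  define j :: nat where "j = (if \<nu> = 1 then 0 else 1)"
  have j: "\<nu> = (-1) ^ j" "j \<le> 1"
    using assms(15) by (auto simp: j_def)
  let ?L0 = "half_eigenvalue \<alpha>m \<eta>m \<alpha>p \<eta>p k ((-1) ^ j) f0 f0"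
  let ?L1 = "half_eigenvalue \<alpha>m \<eta>m \<alpha>p \<eta>p k ((-1) ^ j) f_inf f_minf"
  have cross: "(?L0 - 1) * (?L1 - 1) < 0"
    using assms(16) eigenvalue_half_eigenvalue[OF \<open>f0 > 0\<close> \<open>k \<ge> 1\<close> \<alpha> \<eta> j(2)] by (simp add: j(1))
  \<comment> \<open>Of the two possible orderings of the half-eigenvalues around 1, the sign selects
    the one at hand, so the defect goes from negative to positive after multiplication by
    it.\<close>
  define \<epsilon> where "\<epsilon> = sgn (?L1 - 1)"
  have \<epsilon>: "\<epsilon> = 1 \<and> ?L0 < 1 \<and> ?L1 > 1 \<or> \<epsilon> = -1 \<and> ?L0 > 1 \<and> ?L1 < 1"
    using cross by (auto simp: \<epsilon>_def sgn_if mult_less_0_iff)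
  obtain s t where s: "0 < s" "s < 1" and
    t: "phase (g s) t \<in> arc j" "phase (g s) (t + 2 * 1) \<in> arc (j + k)"
      "end_bc (-1) \<alpha>m \<eta>m (g s) 1 t = 0" "end_bc 1 \<alpha>p \<eta>p (g s) 1 (t + 2 * 1) = 0"
  proof (rule shooting[of c1 c2 g "\<lambda>_. 1" \<alpha>m \<alpha>p j k \<eta>m \<eta>p \<epsilon>])
    show "continuous_on ({0..1} \<times> UNIV) (\<lambda>(s, x). g s x)"
      unfolding g_def by (rule rescaled_continuous[OF r_cont r_bounds c r_lim])
  next
    fix \<theta> \<phi> assume "\<theta> \<in> arc j" "\<phi> \<in> arc (j + k)"
      "end_bc (-1) \<alpha>m \<eta>m (g 0) 1 (time (g 0) \<theta>) = 0" "end_bc 1 \<alpha>p \<eta>p (g 0) 1 (time (g 0) \<phi>) = 0"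
    then show "\<epsilon> * (time (g 0) \<phi> - time (g 0) \<theta> - 2 * 1) < 0"
      using half_eigenvalue_order[OF \<open>f0 > 0\<close> \<open>f0 > 0\<close> \<open>k \<ge> 1\<close> \<alpha> \<eta>] \<epsilon> unfolding g0 by fastforce
  next
    fix \<theta> \<phi> assume "\<theta> \<in> arc j" "\<phi> \<in> arc (j + k)"
      "end_bc (-1) \<alpha>m \<eta>m (g 1) 1 (time (g 1) \<theta>) = 0" "end_bc 1 \<alpha>p \<eta>p (g 1) 1 (time (g 1) \<phi>) = 0"
    then show "\<epsilon> * (time (g 1) \<phi> - time (g 1) \<theta> - 2 * 1) > 0"
      using half_eigenvalue_order[OF assms(7,9) \<open>k \<ge> 1\<close> \<alpha> \<eta>] \<epsilon> unfolding g1 by fastforce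
  qed (use sec \<alpha> \<epsilon> in auto)
  \<comment> \<open>Undoing the rescaling: because 0 < s < 1, the energy radius \<open>R\<close> is
    finite and positive, and \<open>R\<close> times the orbit solves the original equation.\<close>
  define R where "R = s / (1 - s)"
  have "R > 0"
    using s by (simp add: R_def)
  define u where "u = (\<lambda>x. R * orbit (g s) (t + 1 * (x + 1)))"
  have "u \<in> T \<alpha>m \<eta>m \<alpha>p \<eta>p k \<nu>"
    unfolding u_def j(1) by (rule orbit_in_T(1)[OF sec \<open>R > 0\<close> zero_less_one t])
  moreover have "- D (D u) x = f (u x)" if "x \<in> {-1<..<1}" for x
  proof -
    have "D (D u) x = - (R * 1\<^sup>2 * g s (orbit (g s) (t + 1 * (x + 1))))"
      unfolding u_def by (rule orbit_in_T(2)[OF sec \<open>R > 0\<close> zero_less_one t]) (use that in auto)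
    also have "R * 1\<^sup>2 * g s y = f (R * y)" for y
      using s by (simp add: g_def rescaled_def f_r flip: R_def)
    finally show ?thesis
      by (simp add: u_def)
  qed
  ultimately show ?thesis
    by blast
qed

end
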